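(* Let $G$ be a finite group, $p$ a prime divisor of $|G|$ with $(p-1,|G|)=1$, and $S$ a Sylow $p$-subgroup of $G$. Assume that there exists a subgroup $D$ of $S$ with $1<|D|<|S|$ such that every subgroup of $S$ of order $|D|$ is abelian and satisfies the $S$-subnormalizer condition in $G$, and every subgroup of $S$ of order $p|D|$ is abelian. If $S$ is non-abelian, $p=2$ and $|D|=2$, assume moreover that every cyclic subgroup of $S$ of order $4$ satisfies the $S$-subnormalizer condition in $G$. Then $G$ is $p$-nilpotent.
   Context: For a finite group $G$ and $S\in\mathrm{Syl}_p(G)$, a subgroup $H\le S$ satisfies the $S$-subnormalizer condition in $G$ if $N_G(K)\le N_G(H)$ for every subgroup $K$ with $H\le K\le S$. *)

theory Defs
  imports "HOL-Algebra.Algebra"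
begin

definition sylow_subgroup :: "nat \<Rightarrow> ('a, 'b) monoid_scheme \<Rightarrow> 'a set \<Rightarrow> bool" where
  "sylow_subgroup p G S \<longleftrightarrow> subgroup S G \<and> card S = p ^ multiplicity p (order G)"

text \<open>
  The \<open>S\<close>-subnormalizer condition, to be used for subgroups \<open>H\<close> of \<open>S\<close>. The intermediate
  subgroup \<open>K\<close> is not required to normalize \<open>H\<close>; this follows from the inclusion, as
  \<open>K\<close> is contained in its own normalizer.
\<close>

definition subnormalizer_condition :: "('a, 'b) monoid_scheme \<Rightarrow> 'a set \<Rightarrow> 'a set \<Rightarrow> bool" where
  "subnormalizer_condition G S H \<longleftrightarrow>
     (\<forall>K. subgroup K G \<and> H \<subseteq> K \<and> K \<subseteq> S \<longrightarrow> normalizer G K \<subseteq> normalizer G H)"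

text \<open>
  A finite group is \<open>p\<close>-nilpotent if it has a normal \<open>p\<close>-complement: a normal subgroup of
  order prime to \<open>p\<close> whose index is a power of \<open>p\<close>.
\<close>

definition p_nilpotent :: "nat \<Rightarrow> ('a, 'b) monoid_scheme \<Rightarrow> bool" where
  "p_nilpotent p G \<longleftrightarrow>
     (\<exists>N. N \<lhd> G \<and> coprime p (card N) \<and> (\<exists>k. order (G Mod N) = p ^ k))"

end

theory Submission
  imports Defs "HOL-Number_Theory.Residues"
begin

text \<open>
  By Frobenius' criterion it suffices that a \<open>p\<close>-regular element \<open>x\<close> normalizing a
  \<open>p\<close>-subgroup \<open>K\<close> centralizes it. If \<open>K \<le> S\<close> and \<open>|K| > |D|\<close>, the subnormalizer condition makes
  \<open>x\<close> normalize every subgroup \<open>H\<close> of \<open>K\<close> of order \<open>|D|\<close>. Such an \<open>H\<close> lies in an abelian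
  \<open>L \<le> K\<close> of order \<open>p |D|\<close>, and \<open>x\<close> acts trivially on all sections of order \<open>p\<close> because
  \<open>(p - 1, |G|) = 1\<close>; hence \<open>x\<close> centralizes \<open>H\<close>. So \<open>x\<close> centralizes the elements of \<open>K\<close> of
  order \<open>p\<close> (and \<open>4\<close>, where needed), and therefore \<open>K\<close>. Smaller \<open>K\<close> are reduced to this case by a
  Frattini argument in the centralizer of \<open>K\<close>.

  For Frobenius' criterion, the hypothesis makes \<open>S\<close> control fusion, so the transfer into a
  quotient of \<open>S\<close> of order \<open>p\<close> has a proper kernel containing all \<open>p\<close>-regular elements, and
  induction shows that these form a subgroup.
\<close>

section \<open>Conjugation and \<open>p\<close>-subgroups\<close>

text \<open>The obstacle is that \<open>x\<close> is only known to normalize the subgroups of order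
  \<open>|D|\<close>, not \<open>L\<close> itself. If \<open>L\<close> has two such subgroups, they
  generate \<open>L\<close>, so \<open>x\<close> normalizes \<open>L\<close>; being trivial on every
  quotient of order \<open>p\<close>, it moves each element of \<open>L\<close> by a
  \<open>p\<close>-th power only, and coprime action makes these displacements trivial. If
  \<open>L\<close> has only one, then \<open>L\<close> is cyclic and so is \<open>H\<close>. The
  automorphism group of a cyclic group of order \<open>p ^ k\<close> has order
  \<open>p ^ (k - 1) * (p - 1)\<close>, so \<open>x\<close> centralizes \<open>H\<close> without any
  information on \<open>L\<close>.

  Elements of order 4 are a genuine obstruction for \<open>p = 2\<close>: the quaternion group of
  order 8 has an automorphism of order 3 that fixes its only involution. They call for a hypothesis
  of their own only when \<open>|D| = 2\<close>, because for larger \<open>|D|\<close> a cyclic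
  subgroup of order 4 is contained in some \<open>H\<close> of order \<open>|D|\<close>.\<close>

context group
begin

definition cj :: "'a \<Rightarrow> 'a \<Rightarrow> 'a" where
  "cj g x = g \<otimes> x \<otimes> inv g"

definition norm_of :: "'a set \<Rightarrow> 'a set" where
  "norm_of K = {g \<in> carrier G. cj g ` K = K}"

definition cent_of :: "'a set \<Rightarrow> 'a set" where
  "cent_of K = {g \<in> carrier G. \<forall>x\<in>K. cj g x = x}"

lemma mult_inv_cancel [simp]:
  assumes "x \<in> carrier G" "y \<in> carrier G"
  shows "x \<otimes> (inv x \<otimes> y) = y" "inv x \<otimes> (x \<otimes> y) = y"
  using assms by (simp_all flip: m_assoc)

lemma cj_closed [simp]: "\<lbrakk>g \<in> carrier G; x \<in> carrier G\<rbrakk> \<Longrightarrow> cj g x \<in> carrier G"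
  by (simp add: cj_def)

lemma cj_mult:
  "\<lbrakk>g \<in> carrier G; x \<in> carrier G; y \<in> carrier G\<rbrakk> \<Longrightarrow> cj g (x \<otimes> y) = cj g x \<otimes> cj g y"
  by (simp add: cj_def m_assoc)

lemma cj_one [simp]: "g \<in> carrier G \<Longrightarrow> cj g \<one> = \<one>" "x \<in> carrier G \<Longrightarrow> cj \<one> x = x"
  by (simp_all add: cj_def)

lemma cj_inv: "\<lbrakk>g \<in> carrier G; x \<in> carrier G\<rbrakk> \<Longrightarrow> cj g (inv x) = inv (cj g x)"
  by (simp add: cj_def m_assoc inv_mult_group)

lemma cj_comp:
  "\<lbrakk>g \<in> carrier G; h \<in> carrier G; x \<in> carrier G\<rbrakk> \<Longrightarrow> cj (g \<otimes> h) x = cj g (cj h x)"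
  by (simp add: cj_def m_assoc inv_mult_group)

lemma cj_pow: "\<lbrakk>g \<in> carrier G; x \<in> carrier G\<rbrakk> \<Longrightarrow> cj g (x [^] (n::nat)) = cj g x [^] n"
  by (induction n) (simp_all add: cj_mult)

lemma cj_cancel [simp]:
  "\<lbrakk>g \<in> carrier G; x \<in> carrier G\<rbrakk> \<Longrightarrow> cj g (cj (inv g) x) = x"
  "\<lbrakk>g \<in> carrier G; x \<in> carrier G\<rbrakk> \<Longrightarrow> cj (inv g) (cj g x) = x"
  by (simp_all flip: cj_comp)

lemma cj_fixed_iff:
  assumes "g \<in> carrier G" "x \<in> carrier G"
  shows "cj g x = x \<longleftrightarrow> g \<otimes> x = x \<otimes> g"
  using assms unfolding cj_def by (metis inv_solve_right m_closed)

lemma cj_inj_on: "\<lbrakk>g \<in> carrier G; K \<subseteq> carrier G\<rbrakk> \<Longrightarrow> inj_on (cj g) K"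
  by (rule inj_on_inverseI[of _ "cj (inv g)"]) auto

lemma cj_image_comp:
  "\<lbrakk>g \<in> carrier G; h \<in> carrier G; K \<subseteq> carrier G\<rbrakk> \<Longrightarrow> cj (g \<otimes> h) ` K = cj g ` cj h ` K"
  unfolding image_image by (rule image_cong) (auto simp: cj_comp)

lemma cj_image_one: "K \<subseteq> carrier G \<Longrightarrow> cj \<one> ` K = K"
  by (force simp: image_def)

lemma cj_image_cancel:
  assumes "g \<in> carrier G" "K \<subseteq> carrier G"
  shows "cj g ` cj (inv g) ` K = K" "cj (inv g) ` cj g ` K = K"
  using assms by (simp_all add: cj_image_one flip: cj_image_comp)

lemma cj_image_card: "\<lbrakk>g \<in> carrier G; K \<subseteq> carrier G\<rbrakk> \<Longrightarrow> card (cj g ` K) = card K"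
  by (simp add: cj_inj_on card_image)

lemma subgroup_cj:
  assumes "subgroup K G" "g \<in> carrier G"
  shows "subgroup (cj g ` K) G"
proof (rule subgroupI)
  interpret K: subgroup K G by fact
  show "cj g ` K \<subseteq> carrier G" using assms by auto
  show "cj g ` K \<noteq> {}" using K.one_closed by blast
  show "inv a \<in> cj g ` K" if "a \<in> cj g ` K" for a
    using that assms by (auto simp flip: cj_inv)
  show "a \<otimes> b \<in> cj g ` K" if "a \<in> cj g ` K" "b \<in> cj g ` K" for a b
    using that assms by (auto simp flip: cj_mult)
qed

lemma norm_of_iff_subset:
  assumes "finite K" "K \<subseteq> carrier G"
  shows "g \<in> norm_of K \<longleftrightarrow> g \<in> carrier G \<and> cj g ` K \<subseteq> K"
  unfolding norm_of_def using assms card_subset_eq[of K "cj g ` K"] cj_image_card[of g K] by auto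

lemma norm_of_subgroup:
  assumes "K \<subseteq> carrier G"
  shows "subgroup (norm_of K) G"
proof (rule subgroupI)
  show "norm_of K \<subseteq> carrier G" by (auto simp: norm_of_def)
  have "\<one> \<in> norm_of K" using cj_image_one[OF assms] by (simp add: norm_of_def)
  then show "norm_of K \<noteq> {}" by blast
  show "inv a \<in> norm_of K" if "a \<in> norm_of K" for a
    using that cj_image_cancel(2)[of a K] assms by (auto simp: norm_of_def)
  show "a \<otimes> b \<in> norm_of K" if "a \<in> norm_of K" "b \<in> norm_of K" for a b
    using that assms by (auto simp: norm_of_def cj_image_comp)
qed

lemma cent_of_subgroup:
  assumes "K \<subseteq> carrier G"
  shows "subgroup (cent_of K) G"
proof (rule subgroupI)
  show "cent_of K \<subseteq> carrier G" by (auto simp: cent_of_def)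
  have "\<one> \<in> cent_of K" using assms by (auto simp: cent_of_def)
  then show "cent_of K \<noteq> {}" by blast
  show "inv a \<in> cent_of K" if "a \<in> cent_of K" for a
  proof -
    have "cj (inv a) x = x" if "x \<in> K" for x
      proof -
      have "a \<in> carrier G" "x \<in> carrier G" "cj a x = x"
        using \<open>a \<in> cent_of K\<close> that assms by (auto simp: cent_of_def)
      then show ?thesis using cj_cancel(2)[of a x] by simp
    qed
    then show ?thesis using that by (auto simp: cent_of_def)
  qed
  show "a \<otimes> b \<in> cent_of K" if "a \<in> cent_of K" "b \<in> cent_of K" for a b
    using that assms by (auto simp: cent_of_def cj_comp subset_iff)
qed

lemma cent_of_subset_norm_of: "K \<subseteq> carrier G \<Longrightarrow> cent_of K \<subseteq> norm_of K"
  by (force simp: cent_of_def norm_of_def image_def)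

lemma cent_of_antimono: "K \<subseteq> L \<Longrightarrow> cent_of L \<subseteq> cent_of K"
  by (auto simp: cent_of_def)

text \<open>Normality of the centralizer in the normalizer: it closes the products in
  \<open>norm_of_decompose\<close> under multiplication and keeps conjugates of \<open>P\<close>
  inside the centralizer in the final Frattini argument.\<close>

lemma cent_of_cj:
  assumes "K \<subseteq> carrier G" "g \<in> norm_of K" "c \<in> cent_of K"
  shows "cj g c \<in> cent_of K"
proof -
  have g: "g \<in> carrier G" and c: "c \<in> carrier G" and gK: "cj g ` K = K"
    using assms by (auto simp: norm_of_def cent_of_def)
  have "cj (cj g c) x = x" if x: "x \<in> K" for x
  proof -
    have "x \<in> cj g ` K" using gK x by simp
    then obtain y where y: "y \<in> K" "x = cj g y" by (rule imageE)
    have yc: "y \<in> carrier G" "cj c y = y" using y(1) assms(1,3) by (auto simp: cent_of_def)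
    have "cj (cj g c) (cj g y) = cj g (cj c y)"
      using yc(1) g c by (simp add: cj_def m_assoc inv_mult_group)
    then show ?thesis using yc y by simp
  qed
  then show ?thesis using g c by (simp add: cent_of_def)
qed

lemma subgroup_subset_norm_of:
  assumes "subgroup K G"
  shows "K \<subseteq> norm_of K"
proof
  interpret K: subgroup K G by fact
  fix g assume g: "g \<in> K"
  have "cj g ` K \<subseteq> K" using g by (auto simp: cj_def)
  moreover have "x \<in> cj g ` K" if "x \<in> K" for x
  proof -
    have "x = cj g (cj (inv g) x)" "cj (inv g) x \<in> K"
      using that g by (auto, simp add: cj_def)
    then show ?thesis by blast
  qed
  ultimately show "g \<in> norm_of K" using g by (auto simp: norm_of_def)
qed

lemma normalizer_eq_norm_of:
  assumes "K \<subseteq> carrier G"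
  shows "normalizer G K = norm_of K"
proof -
  have "(g <# K) #> inv g = cj g ` K" if "g \<in> carrier G" for g
    by (auto simp: l_coset_def r_coset_def cj_def)
  then show ?thesis
    using assms by (auto simp: normalizer_def stabilizer_def norm_of_def)
qed

lemma cj_restrict:
  assumes "subgroup U G"
  shows "g \<in> U \<Longrightarrow> group.cj (G\<lparr>carrier := U\<rparr>) g x = cj g x"
proof -
  interpret U: group "G\<lparr>carrier := U\<rparr>" using assms by (rule subgroup_imp_group)
  show "g \<in> U \<Longrightarrow> group.cj (G\<lparr>carrier := U\<rparr>) g x = cj g x"
    unfolding cj_def U.cj_def using assms by (simp add: m_inv_consistent)
qed

end

section \<open>Counting fixed cosets modulo \<open>p\<close>\<close>

locale finite_group_prime = group +
  fixes p :: nat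
  assumes finite_carrier: "finite (carrier G)"
    and prime_p: "Factorial_Ring.prime p"
begin

lemma finite_group_prime_restrict:
  assumes "subgroup U G"
  shows "finite_group_prime (G\<lparr>carrier := U\<rparr>) p"
proof -
  have "finite U" using assms finite_carrier finite_subset subgroup.subset by metis
  then show ?thesis
    using assms prime_p
    by (simp add: finite_group_prime_def finite_group_prime_axioms_def subgroup_imp_group)
qed

lemma finite_subgroup: "subgroup U G \<Longrightarrow> finite U"
  using finite_carrier finite_subset subgroup.subset by metis

lemma card_subgroup_dvd:
  assumes "subgroup U G" "subgroup V G" "U \<subseteq> V"
  shows "card U dvd card V"
proof -
  interpret V: group "G\<lparr>carrier := V\<rparr>" using assms(2) by (rule subgroup_imp_group)
  have "subgroup U (G\<lparr>carrier := V\<rparr>)" using assms subgroup_incl by blast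
  from V.lagrange[OF this] have "card V = card (rcosets\<^bsub>G\<lparr>carrier := V\<rparr>\<^esub> U) * card U"
    by (simp add: order_def)
  then show ?thesis by (rule dvdI[OF trans[OF _ mult.commute]])
qed

lemma card_subgroup_pos: "subgroup U G \<Longrightarrow> card U > 0"
  using finite_subgroup subgroup.finite_imp_card_positive finite_carrier by blast

lemma subgroup_of_prime_power:
  assumes "subgroup U G" "card U = p ^ n" "subgroup V G" "V \<subseteq> U"
  obtains k where "card V = p ^ k" "k \<le> n"
  using card_subgroup_dvd[OF assms(3,1,4)] assms(2) divides_primepow_nat[OF prime_p] by auto

text \<open>The orbits of \<open>Q\<close> on the cosets of \<open>S\<close> have prime power length, so modulo \<open>p\<close> only
  the fixed cosets count.\<close>

lemma card_fixed_rcosets: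
  assumes S: "subgroup S G" and Q: "subgroup Q G" "card Q = p ^ k"
  shows "card {c \<in> rcosets S. \<forall>q\<in>Q. c #> q = c} mod p = card (rcosets S) mod p"
proof -
  interpret Q: subgroup Q G by fact
  let ?E = "rcosets S" and ?Q = "G\<lparr>carrier := Q\<rparr>"
  \<comment> \<open>The inverse turns right multiplication into a homomorphism to
    \<open>BijGroup\<close>; the restriction makes the maps extensional, as \<open>Bij\<close>
    requires.\<close>
  let ?\<phi> = "\<lambda>q. \<lambda>c\<in>rcosets S. c #> inv q"
  have sub: "c \<subseteq> carrier G" if "c \<in> ?E" for c
    using that S subgroup.rcosets_carrier[OF S] group_axioms by blast
  have closed: "c #> q \<in> ?E" if "c \<in> ?E" "q \<in> carrier G" for c q
    using that S by (auto simp: RCOSETS_def coset_mult_assoc subgroup.subset)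
  have bij: "?\<phi> q \<in> Bij ?E" if "q \<in> Q" for q
  proof -
    have q: "q \<in> carrier G" using that by simp
    have "bij_betw (\<lambda>c. c #> inv q) ?E ?E"
      by (rule bij_betw_byWitness[of _ "\<lambda>c. c #> q"])
        (use q closed sub in \<open>auto simp: coset_mult_assoc\<close>)
    then show ?thesis by (auto simp: Bij_def)
  qed
  interpret act: group_action ?Q ?E ?\<phi>
  proof -
    have "group_hom ?Q (BijGroup ?E) ?\<phi>"
    proof (rule group_hom.intro)
      show "group ?Q" using Q by (simp add: subgroup_imp_group)
      show "group (BijGroup ?E)" by (rule group_BijGroup)
      show "group_hom_axioms ?Q (BijGroup ?E) ?\<phi>"
      proof (rule group_hom_axioms.intro, rule homI)
        show "?\<phi> x \<in> carrier (BijGroup ?E)" if "x \<in> carrier ?Q" for x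
          using that bij by (simp add: BijGroup_def)
        show "?\<phi> (x \<otimes>\<^bsub>?Q\<^esub> y) = ?\<phi> x \<otimes>\<^bsub>BijGroup ?E\<^esub> ?\<phi> y"
          if "x \<in> carrier ?Q" "y \<in> carrier ?Q" for x y
        proof -
          have x: "x \<in> Q" "x \<in> carrier G" and y: "y \<in> Q" "y \<in> carrier G" using that by auto
          show ?thesis
            using x y bij closed sub
            by (auto simp: BijGroup_def compose_def inv_mult_group coset_mult_assoc fun_eq_iff restrict_def)
        qed
      qed
    qed
    then show "group_action ?Q ?E ?\<phi>" by (simp add: group_action_def)
  qed
  have finE: "finite ?E"
    using finite_carrier rcosets_subset_PowG[OF S] finite_subset by blast
  have orb: "act_orb = {c #> q |q. q \<in> Q}" if "c \<in> ?E" "act_orb = orbit ?Q ?\<phi> c" for c act_orb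
  proof -
    have "(\<lambda>q. c #> inv q) ` Q = (\<lambda>q. c #> q) ` Q"
      by (auto simp: image_iff) (metis Q.m_inv_closed Q.mem_carrier inv_inv)+
    moreover have "act_orb = (\<lambda>q. c #> inv q) ` Q"
      using that by (auto simp: orbit_def image_iff)
    ultimately show ?thesis by (auto simp: image_iff)
  qed
  let ?O = "orbits ?Q ?E ?\<phi>" and ?F = "{c \<in> ?E. \<forall>q\<in>Q. c #> q = c}"
  have "card (rcosets S) = (\<Sum>w\<in>?O. card w)"
    using act.disjoint_sum[OF finE, of "\<lambda>_. 1 :: nat"] by (simp only: card_eq_sum)
  also have "\<dots> = (\<Sum>w\<in>?O. if card w = 1 then 1 else 0) + (\<Sum>w\<in>?O. if card w = 1 then 0 else card w)"
    by (subst sum.distrib[symmetric], rule sum.cong) auto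
  also have "(\<Sum>w\<in>?O. if card w = 1 then 1 else 0) = card {w \<in> ?O. card w = 1}"
    using finE by (simp add: orbits_def sum.If_cases Int_def)
  also have "card {w \<in> ?O. card w = 1} = card ?F"
  proof -
    have "bij_betw (\<lambda>c. {c}) ?F {w \<in> ?O. card w = 1}"
    proof (rule bij_betw_imageI)
      show "inj_on (\<lambda>c. {c}) ?F" by (auto simp: inj_on_def)
      show "(\<lambda>c. {c}) ` ?F = {w \<in> ?O. card w = 1}"
      proof (intro equalityI subsetI)
        fix o' assume "o' \<in> (\<lambda>c. {c}) ` ?F"
        then obtain c where c: "c \<in> ?E" "\<forall>q\<in>Q. c #> q = c" "o' = {c}" by auto
        have "orbit ?Q ?\<phi> c = (\<lambda>q. c #> q) ` Q" using orb[OF c(1) refl] by blast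
        also have "\<dots> = (\<lambda>_. c) ` Q" by (rule image_cong[OF refl]) (rule bspec[OF c(2)])
        also have "\<dots> = {c}" using Q.one_closed by (rule image_constant)
        finally have "orbit ?Q ?\<phi> c = {c}" .
        then show "o' \<in> {w \<in> ?O. card w = 1}" using c by (auto simp: orbits_def)
      next
        fix o' assume "o' \<in> {w \<in> ?O. card w = 1}"
        then obtain c where c: "c \<in> ?E" "o' = orbit ?Q ?\<phi> c" "card o' = 1" by (auto simp: orbits_def)
        have oeq: "o' = {c #> q |q. q \<in> Q}" using orb[OF c(1,2)] .
        have "c #> \<one> = c" using c(1) sub by simp
        then have "c \<in> o'" using oeq Q.one_closed by (metis (mono_tags, lifting) mem_Collect_eq)
        then have "o' = {c}" using c(3) by (metis card_1_singletonE singletonD)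
        then have "\<forall>q\<in>Q. c #> q = c" using oeq by blast
        then show "o' \<in> (\<lambda>c. {c}) ` ?F" using c(1) \<open>o' = {c}\<close> by auto
      qed
    qed
    then show ?thesis by (simp add: bij_betw_same_card)
  qed
  finally have eq: "card (rcosets S) = card ?F + (\<Sum>w\<in>?O. if card w = 1 then 0 else card w)" .
  have "p dvd (\<Sum>w\<in>?O. if card w = 1 then 0 else card w)"
  proof (rule dvd_sum)
    fix o' assume "o' \<in> ?O"
    then obtain c where c: "c \<in> ?E" "o' = orbit ?Q ?\<phi> c" by (auto simp: orbits_def)
    have "card o' * card (stabilizer ?Q ?\<phi> c) = p ^ k"
      using act.orbit_stabilizer_theorem[OF c(1)] Q(2) c(2) by (simp add: order_def)
    then have "card o' dvd p ^ k" by (metis dvd_triv_left)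
    then obtain j where "card o' = p ^ j" using divides_primepow_nat[OF prime_p] by auto
    then show "p dvd (if card o' = 1 then 0 else card o')" by (cases j) auto
  qed
  then obtain m where "(\<Sum>w\<in>?O. if card w = 1 then 0 else card w) = p * m" by (rule dvdE)
  then show ?thesis by (simp only: eq) simp
qed

end

lemma exists_other_if_dvd_card:
  assumes "finite F" "a \<in> F" "p dvd card F" "p > (1 :: nat)"
  obtains b where "b \<in> F" "b \<noteq> a"
proof -
  have "card F \<noteq> 1" using assms(3,4) by auto
  then have "F \<noteq> {a}" by auto
  then show ?thesis using that assms(2) by blast
qed

context group
begin

lemma subgroup_nat_pow: "subgroup H G \<Longrightarrow> x \<in> H \<Longrightarrow> x [^] (n::nat) \<in> H"
  by (induction n) (auto simp: subgroup.one_closed subgroup.m_closed)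

text \<open>Reads off fixed points of the coset action: for cosets of \<open>H\<close> under
  \<open>H\<close> they give normalizing elements, for cosets of a Sylow subgroup they give
  conjugation into it.\<close>

lemma rcoset_fixed_imp:
  assumes "subgroup S G" "g \<in> carrier G" "q \<in> carrier G" "(S #> g) #> q = S #> g"
  shows "cj g q \<in> S"
proof -
  interpret S: subgroup S G by fact
  have "S #> g = S #> (g \<otimes> q)" using assms by (simp add: coset_mult_assoc S.subset)
  then have "g \<otimes> q \<in> S #> g" using repr_independenceD[OF assms(1) _ ] assms by simp
  then show ?thesis
    using S.rcos_module[OF group_axioms, of g "g \<otimes> q"] assms by (simp add: cj_def)
qed

lemma subgroup_finiteI:
  assumes "finite (carrier G)" "H \<subseteq> carrier G" "\<one> \<in> H"
    and "\<And>x y. \<lbrakk>x \<in> H; y \<in> H\<rbrakk> \<Longrightarrow> x \<otimes> y \<in> H"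
  shows "subgroup H G"
proof (rule subgroupI)
  show "inv x \<in> H" if x: "x \<in> H" for x
  proof -
    have xG: "x \<in> carrier G" using x assms by blast
    have pw: "x [^] (n::nat) \<in> H" for n using x assms by (induction n) auto
    obtain k where k: "order G = Suc k"
      using assms(1) order_gt_0_iff_finite gr0_implies_Suc by blast
    have "x \<otimes> x [^] k = \<one>"
      using pow_order_eq_1[OF xG] k xG nat_pow_Suc2[of x k] by simp
    then have "inv x = x [^] k" using xG by (metis inv_equality nat_pow_closed inv_comm)
    then show ?thesis using pw by simp
  qed
qed (use assms in auto)

end

section \<open>Chains of subgroups in a \<open>p\<close>-group\<close>

context finite_group_prime
begin

definition p_subgroup :: "'a set \<Rightarrow> bool" where
  "p_subgroup H \<longleftrightarrow> subgroup H G \<and> (\<exists>k. card H = p ^ k)"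

text \<open>Sylow subgroups of normalizers and centralizers are needed. The notion is relative to
  \<open>U\<close> but keeps the structure of \<open>G\<close>, so that such subgroups can be
  compared and conjugated inside \<open>G\<close>.\<close>

definition sylow_in :: "'a set \<Rightarrow> 'a set \<Rightarrow> bool" where
  "sylow_in U S \<longleftrightarrow> subgroup S G \<and> S \<subseteq> U \<and> card S = p ^ multiplicity p (card U)"

lemma p_gt_1: "p > 1"
  using prime_p by (rule prime_gt_1_nat)

lemma p_subgroup_subset: "p_subgroup U \<Longrightarrow> subgroup V G \<Longrightarrow> V \<subseteq> U \<Longrightarrow> p_subgroup V"
  unfolding p_subgroup_def using subgroup_of_prime_power by metis

lemma p_subgroup_exponent:
  assumes "p_subgroup P"
  obtains n where "\<And>x. x \<in> P \<Longrightarrow> x [^] (p ^ n) = \<one>"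
proof -
  obtain n where n: "subgroup P G" "card P = p ^ n" using assms by (auto simp: p_subgroup_def)
  interpret P: group "G\<lparr>carrier := P\<rparr>" using n(1) by (rule subgroup_imp_group)
  have "x [^] (p ^ n) = \<one>" if "x \<in> P" for x
    using P.pow_order_eq_1[of x] that n(2) by (simp add: order_def flip: nat_pow_consistent)
  then show ?thesis using that by blast
qed

text \<open>\<open>H\<close> acts on the cosets of \<open>H\<close> in \<open>P\<close>, whose
  number is a positive power of \<open>p\<close>. So the number of fixed cosets is divisible by
  \<open>p\<close>, and besides \<open>H\<close> itself some \<open>H #> g\<close> is fixed; such a
  \<open>g\<close> normalizes \<open>H\<close>.\<close>

lemma normalizer_grows:
  assumes "p_subgroup P" "subgroup H G" "H \<subset> P"
  obtains g where "g \<in> P" "g \<notin> H" "g \<in> norm_of H"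
proof -
  obtain n where P: "subgroup P G" "card P = p ^ n" using assms by (auto simp: p_subgroup_def)
  interpret P: finite_group_prime "G\<lparr>carrier := P\<rparr>" p by (rule finite_group_prime_restrict[OF P(1)])
  obtain k where k: "card H = p ^ k"
    using subgroup_of_prime_power[OF P assms(2)] assms(3) by blast
  have HP: "subgroup H (G\<lparr>carrier := P\<rparr>)" using subgroup_incl assms P by blast
  let ?R = "rcosets\<^bsub>G\<lparr>carrier := P\<rparr>\<^esub> H"
  let ?F = "{c \<in> ?R. \<forall>q\<in>H. c #> q = c}"
  have R: "?R = {H #> g |g. g \<in> P}" by (auto simp: RCOSETS_def)
  have lag: "card ?R * p ^ k = p ^ n"
    using P.lagrange[OF HP] P(2) k by (simp add: order_def)
  have "card H < card P" using assms(3) finite_subgroup[OF P(1)] psubset_card_mono by blast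
  then have "card ?R \<noteq> 1" using lag P(2) k by auto
  moreover have "card ?R dvd p ^ n" using lag by (metis dvd_triv_left)
  ultimately have "p dvd card ?R"
    using divides_primepow_nat[OF prime_p, of "card ?R" n] by (auto intro: dvd_power gr0I)
  then have F: "p dvd card ?F"
    using P.card_fixed_rcosets[OF HP HP k] by (simp add: dvd_eq_mod_eq_0)
  have "H \<in> ?R" using subgroup.subgroup_in_rcosets[OF HP P.group_axioms] .
  then have HF: "H \<in> ?F" using assms(2) by (auto simp: coset_join2 subgroup.mem_carrier)
  have fin: "finite ?R" unfolding R using finite_subgroup[OF P(1)] by simp
  then have finF: "finite ?F" by (rule finite_subset[rotated]) (rule Collect_restrict)
  obtain c where c: "c \<in> ?F" "c \<noteq> H" by (rule exists_other_if_dvd_card[OF finF HF F p_gt_1])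
  then have cR: "c \<in> ?R" and cfix: "\<forall>q\<in>H. c #> q = c" by simp_all
  obtain g where g: "g \<in> P" "c = H #> g" using cR unfolding R by blast
  have gG: "g \<in> carrier G" using g(1) P(1) subgroup.mem_carrier by metis
  have "g \<notin> H" using c(2) g(2) coset_join2[OF gG assms(2)] by blast
  moreover have "cj g q \<in> H" if "q \<in> H" for q
    using rcoset_fixed_imp[OF assms(2) gG, of q] that cfix g(2) subgroup.mem_carrier[OF assms(2)] by auto
  then have "g \<in> norm_of H"
    using norm_of_iff_subset[OF finite_subgroup[OF assms(2)] subgroup.subset[OF assms(2)], of g] gG by blast
  ultimately show ?thesis using that g(1) by blast
qed

text \<open>Among the iterated \<open>p\<close>-th powers of a normalizing element take the last one
  before they enter \<open>H\<close>.\<close>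

lemma normalizer_grows_prime:
  assumes "p_subgroup P" "subgroup H G" "H \<subset> P"
  obtains g where "g \<in> P" "g \<notin> H" "g \<in> norm_of H" "g [^] p \<in> H"
proof -
  obtain g where g: "g \<in> P" "g \<notin> H" "g \<in> norm_of H" using normalizer_grows[OF assms] .
  have P: "subgroup P G" using assms(1) by (simp add: p_subgroup_def)
  have gG: "g \<in> carrier G" using g(1) P subgroup.mem_carrier by metis
  obtain n where "g [^] (p ^ n) = \<one>" using p_subgroup_exponent[OF assms(1)] g(1) by blast
  then have ex: "g [^] (p ^ n) \<in> H" using assms(2) by (simp add: subgroup.one_closed)
  define m where "m = (LEAST m. g [^] (p ^ m) \<in> H)"
  have m: "g [^] (p ^ m) \<in> H" unfolding m_def using ex by (rule LeastI)
  have "m \<noteq> 0" using m g(2) gG by (metis nat_pow_eone power_0)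
  then obtain l where l: "m = Suc l" using not0_implies_Suc by blast
  have "g [^] (p ^ l) \<notin> H" using not_less_Least[of l "\<lambda>m. g [^] (p ^ m) \<in> H"] l m_def by simp
  moreover have "(g [^] (p ^ l)) [^] p \<in> H" using m l gG by (simp add: nat_pow_pow mult.commute)
  moreover have "g [^] (p ^ l) \<in> P" using subgroup_nat_pow[OF P g(1)] .
  moreover have "g [^] (p ^ l) \<in> norm_of H"
    using subgroup_nat_pow[OF norm_of_subgroup g(3)] assms(2) subgroup.subset by blast
  ultimately show ?thesis using that by blast
qed

text \<open>The products form the group generated by \<open>H\<close> and \<open>h\<close>, and
  exponents below \<open>p\<close> suffice. An upper bound is enough: inside a
  \<open>p\<close>-group, with \<open>h\<close> outside \<open>H\<close>,
  \<open>p_subgroup_card_psubset\<close> supplies the matching lower bound.\<close>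

lemma cyclic_extension:
  assumes "subgroup H G" "h \<in> norm_of H" "h [^] p \<in> H"
  shows "subgroup {k \<otimes> h [^] i |k i::nat. k \<in> H} G" (is "subgroup ?L G")
    and "card {k \<otimes> h [^] i |k i::nat. k \<in> H} \<le> p * card H"
proof -
  interpret H: subgroup H G by fact
  have hG: "h \<in> carrier G" and hH: "cj h ` H = H" using assms(2) by (auto simp: norm_of_def)
  have pw: "cj (h [^] i) k \<in> H" if "k \<in> H" for i :: nat and k
    using subgroup_nat_pow[OF norm_of_subgroup assms(2), of i] that H.subset by (auto simp: norm_of_def)
  show "subgroup ?L G"
  proof (rule subgroup_finiteI[OF finite_carrier])
    show "?L \<subseteq> carrier G" using hG by auto
    have "\<one> = \<one> \<otimes> h [^] (0::nat)" by simp
    then show "\<one> \<in> ?L" using H.one_closed by blast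
    fix x y assume "x \<in> ?L" "y \<in> ?L"
    then obtain k l and i j :: nat where k: "k \<in> H" "x = k \<otimes> h [^] i" and l: "l \<in> H" "y = l \<otimes> h [^] j" by blast
    have "x \<otimes> y = (k \<otimes> cj (h [^] i) l) \<otimes> h [^] (i + j)"
      using k l hG by (simp add: cj_def m_assoc nat_pow_mult[symmetric])
    moreover have "k \<otimes> cj (h [^] i) l \<in> H" using k l pw by blast
    ultimately show "x \<otimes> y \<in> ?L" by blast
  qed
  have "?L \<subseteq> (\<lambda>(i, k). k \<otimes> h [^] i) ` ({..<p} \<times> H)"
  proof
    fix x assume "x \<in> ?L"
    then obtain k and i :: nat where k: "k \<in> H" "x = k \<otimes> h [^] i" by blast
    have "h [^] i = h [^] (p * (i div p)) \<otimes> h [^] (i mod p)" using hG by (simp add: nat_pow_mult)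
    also have "h [^] (p * (i div p)) = (h [^] p) [^] (i div p)" using hG by (simp add: nat_pow_pow)
    finally have "x = (k \<otimes> (h [^] p) [^] (i div p)) \<otimes> h [^] (i mod p)" using k hG by (simp add: m_assoc)
    moreover have "k \<otimes> (h [^] p) [^] (i div p) \<in> H" using k subgroup_nat_pow[OF assms(1,3)] by blast
    moreover have "i mod p < p" using p_gt_1 by simp
    ultimately show "x \<in> (\<lambda>(i, k). k \<otimes> h [^] i) ` ({..<p} \<times> H)" by force
  qed
  then have "card ?L \<le> card ({..<p} \<times> H)"
    using finite_subgroup[OF assms(1)] surj_card_le[of "{..<p} \<times> H"] by blast
  then show "card ?L \<le> p * card H" by (simp only: card_cartesian_product card_lessThan)
qed

lemma cyclic_extension_superset:
  assumes "subgroup H G" "h \<in> carrier G"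
  shows "H \<subseteq> {k \<otimes> h [^] i |k i::nat. k \<in> H}" "h \<in> {k \<otimes> h [^] i |k i::nat. k \<in> H}"
proof -
  interpret H: subgroup H G by fact
  show "H \<subseteq> {k \<otimes> h [^] i |k i::nat. k \<in> H}"
  proof
    fix k assume "k \<in> H"
    moreover from this have "k = k \<otimes> h [^] (0::nat)" by simp
    ultimately show "k \<in> {k \<otimes> h [^] i |k i::nat. k \<in> H}" by blast
  qed
  have "h = \<one> \<otimes> h [^] (1::nat)" using assms by simp
  then show "h \<in> {k \<otimes> h [^] i |k i::nat. k \<in> H}" using H.one_closed by blast
qed

lemma p_subgroup_card_psubset:
  assumes "p_subgroup P" "subgroup H G" "H \<subset> P"
  shows "p * card H dvd card P"
proof -
  obtain n where P: "subgroup P G" "card P = p ^ n" using assms by (auto simp: p_subgroup_def)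
  obtain k where k: "card H = p ^ k" "k \<le> n"
    using subgroup_of_prime_power[OF P assms(2)] assms(3) by blast
  have "card H < card P" using assms(3) finite_subgroup[OF P(1)] psubset_card_mono by blast
  then have "Suc k \<le> n" using k P(2) by (metis le_neq_implies_less less_irrefl Suc_leI)
  then show ?thesis using k P(2) by (metis le_imp_power_dvd power_Suc)
qed

lemma p_subgroup_cover:
  assumes "p_subgroup P" "subgroup H G" "H \<subset> P"
  obtains L where "subgroup L G" "H \<subseteq> L" "L \<subseteq> P" "card L = p * card H"
proof -
  obtain g where g: "g \<in> P" "g \<notin> H" "g \<in> norm_of H" "g [^] p \<in> H"
    using normalizer_grows_prime[OF assms] .
  interpret P: subgroup P G using assms(1) by (simp add: p_subgroup_def)
  have gG: "g \<in> carrier G" using g by simp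
  define L where "L = {k \<otimes> g [^] i |k i::nat. k \<in> H}"
  have L: "subgroup L G" "card L \<le> p * card H"
    unfolding L_def using cyclic_extension[OF assms(2) g(3,4)] by auto
  have HL: "H \<subseteq> L" "g \<in> L"
    unfolding L_def using cyclic_extension_superset[OF assms(2) gG] by auto
  have LP: "L \<subseteq> P"
    unfolding L_def using assms(3) subgroup_nat_pow[OF P.subgroup_axioms g(1)] by auto
  have "p * card H dvd card L"
    using p_subgroup_card_psubset[OF p_subgroup_subset[OF assms(1) L(1) LP] assms(2)] HL g(2) by blast
  then have "card L = p * card H"
    using L(2) dvd_imp_le card_subgroup_pos[OF L(1)] by force
  then show ?thesis using that L(1) HL(1) LP by blast
qed

lemma p_subgroup_between:
  assumes "p_subgroup P" "subgroup H G" "H \<subseteq> P" "card H \<le> p ^ e" "p ^ e \<le> card P"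
  obtains L where "subgroup L G" "H \<subseteq> L" "L \<subseteq> P" "card L = p ^ e"
proof -
  obtain n where P: "subgroup P G" "card P = p ^ n" using assms by (auto simp: p_subgroup_def)
  have "\<exists>L. subgroup L G \<and> H \<subseteq> L \<and> L \<subseteq> P \<and> card L = p ^ e"
    if "subgroup H G" "H \<subseteq> P" "card H \<le> p ^ e" for H
    using that
  proof (induction "p ^ e - card H" arbitrary: H rule: less_induct)
    case less
    obtain k where k: "card H = p ^ k" "k \<le> n"
      using subgroup_of_prime_power[OF P less.prems(1,2)] by blast
    show ?case
    proof (cases "card H = p ^ e")
      case True
      then show ?thesis using less.prems by blast
    next
      case False
      then have lt: "card H < p ^ e" using less.prems by simp
      then have "H \<noteq> P" using assms(5) by auto
      then obtain L where L: "subgroup L G" "H \<subseteq> L" "L \<subseteq> P" "card L = p * card H"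
        using p_subgroup_cover[OF assms(1) less.prems(1)] less.prems(2) by blast
      have "k < e" using lt k p_gt_1 by (simp add: power_strict_increasing_iff)
      then have "card L \<le> p ^ e" using L(4) k p_gt_1 by (metis Suc_leI power_Suc power_increasing less_imp_le)
      moreover have "card H < card L" using L(4) p_gt_1 card_subgroup_pos[OF less.prems(1)] by simp
      ultimately have "\<exists>L'. subgroup L' G \<and> L \<subseteq> L' \<and> L' \<subseteq> P \<and> card L' = p ^ e"
        using less.hyps[OF diff_less_mono2 L(1,3)] lt by blast
      then show ?thesis using L(2) by blast
    qed
  qed
  then show ?thesis using assms that by blast
qed

text \<open>The character stands in for the quotient of \<open>P\<close> by \<open>M\<close>; with complex values the transfer
  becomes an ordinary finite product.\<close>

lemma index_p_character:
  assumes "p_subgroup P" "subgroup M G" "M \<subseteq> P" "card P = p * card M"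
  obtains \<chi> :: "'a \<Rightarrow> complex" and z where
    "\<And>x y. \<lbrakk>x \<in> P; y \<in> P\<rbrakk> \<Longrightarrow> \<chi> (x \<otimes> y) = \<chi> x * \<chi> y"
    "\<And>x. x \<in> P \<Longrightarrow> \<chi> x ^ p = 1"
    "\<And>x. x \<in> P \<Longrightarrow> \<chi> x = 1 \<longleftrightarrow> x \<in> M"
    "z \<in> P" "z \<notin> M" "\<And>x. x \<in> P \<Longrightarrow> \<exists>i. \<chi> x = \<chi> z ^ i"
proof -
  interpret P: subgroup P G using assms by (simp add: p_subgroup_def)
  interpret M: subgroup M G using assms by simp
  have MP: "M \<subset> P" using assms card_subgroup_pos[OF assms(2)] p_gt_1 by auto
  obtain z where z: "z \<in> P" "z \<notin> M" "z \<in> norm_of M" "z [^] p \<in> M"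
    using normalizer_grows_prime[OF assms(1,2) MP] .
  have zG: "z \<in> carrier G" using z by simp
  define L where "L = {k \<otimes> z [^] i |k i::nat. k \<in> M}"
  have L: "subgroup L G" unfolding L_def using cyclic_extension[OF assms(2) z(3,4)] by auto
  have MsL: "M \<subseteq> L" "z \<in> L"
    unfolding L_def using cyclic_extension_superset[OF assms(2) zG] by auto
  have LP: "L \<subseteq> P"
    unfolding L_def using assms(3) subgroup_nat_pow[OF P.subgroup_axioms z(1)] by auto
  \<comment> \<open>\<open>L\<close> lies strictly above \<open>M\<close>, which leaves no room
    between \<open>L\<close> and \<open>P\<close>.\<close>
  have "p * card M dvd card L"
    using p_subgroup_card_psubset[OF p_subgroup_subset[OF assms(1) L(1) LP] assms(2)] MsL z(2) by blast
  then have "card P \<le> card L" using assms(4) dvd_imp_le card_subgroup_pos[OF L] by metis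
  then have PL: "P = L" using card_seteq[of P L] finite_subgroup P.subgroup_axioms LP by blast
  have "\<forall>x\<in>P. \<exists>i. \<exists>k\<in>M. x = k \<otimes> z [^] (i::nat)" unfolding PL L_def by blast
  then obtain e :: "'a \<Rightarrow> nat" where e: "\<And>x. x \<in> P \<Longrightarrow> \<exists>k\<in>M. x = k \<otimes> z [^] e x" by metis
  have zM: "z [^] i \<in> M \<longleftrightarrow> p dvd i" for i :: nat
  proof
    assume "p dvd i"
    then obtain j where "i = p * j" by blast
    then have "z [^] i = (z [^] p) [^] j" using zG by (simp add: nat_pow_pow)
    then show "z [^] i \<in> M" using subgroup_nat_pow[OF assms(2) z(4)] by simp
  next
    assume i: "z [^] i \<in> M"
    show "p dvd i"
    proof (rule ccontr)
      assume "\<not> p dvd i"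
      then have "coprime i p" using prime_p prime_imp_coprime coprime_commute by blast
      moreover have "i \<noteq> 0" using \<open>\<not> p dvd i\<close> by (intro notI) simp
      ultimately obtain a b where "i * a = p * b + 1" using bezout_nat[of i p] by auto
      then have "z [^] (i * a) = z [^] (p * b) \<otimes> z" by simp
      then have "(z [^] i) [^] a = (z [^] p) [^] b \<otimes> z" using zG by (simp add: nat_pow_pow)
      moreover have "(z [^] i) [^] a \<in> M" "(z [^] p) [^] b \<in> M"
        using subgroup_nat_pow[OF assms(2)] i z(4) by auto
      ultimately have "inv ((z [^] p) [^] b) \<otimes> ((z [^] p) [^] b \<otimes> z) \<in> M" by (metis M.m_closed M.m_inv_closed)
      then have "z \<in> M" using zG by simp
      then show False using z by blast
    qed
  qed
  have zcong: "z [^] i \<otimes> inv (z [^] j) \<in> M \<longleftrightarrow> [i = j] (mod p)" for i j :: nat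
  proof (induction i j rule: linorder_wlog)
    case (le i j)
    then obtain d where d: "j = d + i" by (metis le_iff_add add.commute)
    have "z [^] i \<otimes> inv (z [^] j) = inv (z [^] d)"
      using zG by (simp add: d inv_mult_group nat_pow_mult[symmetric])
    moreover have "inv (z [^] d) \<in> M \<longleftrightarrow> z [^] d \<in> M"
      using zG M.m_inv_closed by (metis inv_inv nat_pow_closed)
    ultimately show ?case using zM[of d] d by (simp add: cong_altdef_nat' cong_sym_eq)
  next
    case (sym i j)
    have "inv (z [^] i \<otimes> inv (z [^] j)) = z [^] j \<otimes> inv (z [^] i)"
      using zG by (simp add: inv_mult_group)
    then have "z [^] i \<otimes> inv (z [^] j) \<in> M \<longleftrightarrow> z [^] j \<otimes> inv (z [^] i) \<in> M"
      using zG M.m_inv_closed by (metis inv_inv nat_pow_closed m_closed inv_closed)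
    then show ?case using sym by (simp add: cong_sym_eq)
  qed
  define \<zeta> :: complex where "\<zeta> = cis (2 * pi / real p)"
  have zeta_p: "\<zeta> ^ p = 1" unfolding \<zeta>_def using p_gt_1 by (simp add: DeMoivre)
  have zeta_inj: "\<zeta> ^ i = \<zeta> ^ j \<longleftrightarrow> [i = j] (mod p)" for i j
  proof -
    have red: "\<zeta> ^ i = cis (2 * pi * real (i mod p) / real p)" for i
    proof -
      have "\<zeta> ^ i = \<zeta> ^ (p * (i div p) + i mod p)" by simp
      also have "\<dots> = \<zeta> ^ (i mod p)" using zeta_p by (simp only: power_add power_mult) simp
      also have "\<dots> = cis (2 * pi * real (i mod p) / real p)" by (simp add: \<zeta>_def DeMoivre mult.commute)
      finally show ?thesis .
    qed
    have inj: "inj_on (\<lambda>k. cis (2 * pi * real k / real p)) {..<p}"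
      using bij_betw_imp_inj_on[OF bij_betw_roots_unity[of p]] p_gt_1 by simp
    have "\<zeta> ^ i = \<zeta> ^ j \<longleftrightarrow> i mod p = j mod p"
      unfolding red using inj_on_eq_iff[OF inj, of "i mod p" "j mod p"] p_gt_1 by simp
    then show ?thesis by (simp add: cong_def)
  qed
  \<comment> \<open>\<open>e\<close> picks an arbitrary exponent of \<open>z\<close>; by
    \<open>zcong\<close> the exponent is determined modulo \<open>p\<close>, and \<open>char\<close>
    concludes that every factorization gives the same value.\<close>
  define \<chi> where "\<chi> x = \<zeta> ^ e x" for x
  have char: "\<chi> (k \<otimes> z [^] i) = \<zeta> ^ i" if "k \<in> M" for k i
  proof -
    define x where "x = k \<otimes> z [^] i"
    have "x \<in> P" unfolding PL L_def x_def using that by blast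
    then obtain l where l: "l \<in> M" "x = l \<otimes> z [^] e x" using e by blast
    have "l \<otimes> z [^] e x = k \<otimes> z [^] i" using l(2) x_def by simp
    then have "inv l \<otimes> (l \<otimes> z [^] e x) \<otimes> inv (z [^] i) = inv l \<otimes> (k \<otimes> z [^] i) \<otimes> inv (z [^] i)" by simp
    then have "z [^] e x \<otimes> inv (z [^] i) = inv l \<otimes> k"
      using l(1) that zG by (simp add: m_assoc)
    then have "z [^] e x \<otimes> inv (z [^] i) \<in> M" using l(1) that by (metis M.m_closed M.m_inv_closed)
    then show ?thesis using zcong zeta_inj \<chi>_def x_def by simp
  qed
  have "\<chi> z = \<zeta>" using char[OF M.one_closed, of 1] zG by simp
  show thesis
  proof (rule that[of \<chi> z])
    show "z \<in> P" "z \<notin> M" using z by auto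
    show "\<exists>i. \<chi> x = \<chi> z ^ i" if "x \<in> P" for x
      unfolding \<open>\<chi> z = \<zeta>\<close> unfolding \<chi>_def by blast
  next
    fix x assume x: "x \<in> P"
    then obtain k and i :: nat where k: "k \<in> M" "x = k \<otimes> z [^] i" unfolding PL L_def by blast
    show "\<chi> x ^ p = 1" using zeta_p by (simp add: \<chi>_def flip: power_mult) (simp add: power_mult mult.commute)
    have "\<chi> x = 1 \<longleftrightarrow> p dvd i"
      using char[OF k(1), of i] k(2) zeta_inj[of i 0] by (simp add: cong_0_iff)
    also have "\<dots> \<longleftrightarrow> z [^] i \<in> M" using zM by simp
    also have "\<dots> \<longleftrightarrow> x \<in> M"
    proof
      assume "x \<in> M"
      then have "inv k \<otimes> (k \<otimes> z [^] i) \<in> M" using k by blast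
      then show "z [^] i \<in> M" using k zG by simp
    qed (use k in blast)
    finally show "\<chi> x = 1 \<longleftrightarrow> x \<in> M" .
    fix y assume y: "y \<in> P"
    then obtain l and j :: nat where l: "l \<in> M" "y = l \<otimes> z [^] j" unfolding PL L_def by blast
    have "x \<otimes> y = (k \<otimes> cj (z [^] i) l) \<otimes> z [^] (i + j)"
      using k l zG by (simp add: cj_def m_assoc nat_pow_mult[symmetric])
    moreover have "z [^] i \<in> norm_of M" using subgroup_nat_pow[OF norm_of_subgroup z(3)] M.subset by blast
    then have "k \<otimes> cj (z [^] i) l \<in> M" using k l by (auto simp: norm_of_def)
    ultimately have "\<chi> (x \<otimes> y) = \<zeta> ^ (i + j)" using char by simp
    then show "\<chi> (x \<otimes> y) = \<chi> x * \<chi> y" using char k l by (simp add: power_add)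
  qed
qed

section \<open>Sylow's theorems relative to a subgroup\<close>

lemma sylow_in_exists:
  assumes "subgroup U G"
  obtains S where "sylow_in U S"
proof -
  interpret U: finite_group_prime "G\<lparr>carrier := U\<rparr>" p by (rule finite_group_prime_restrict[OF assms])
  obtain m where "card U = p ^ multiplicity p (card U) * m"
    using multiplicity_dvd[of p "card U"] by (rule dvdE)
  then obtain S where S: "subgroup S (G\<lparr>carrier := U\<rparr>)" "card S = p ^ multiplicity p (card U)"
    using sylow_thm[OF prime_p U.group_axioms _ U.finite_carrier, of "multiplicity p (card U)" m]
    by (auto simp: order_def)
  have "subgroup S G" using incl_subgroup[OF assms S(1)] .
  moreover have "S \<subseteq> U" using subgroup.subset[OF S(1)] by simp
  ultimately show ?thesis using that S(2) by (simp add: sylow_in_def)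
qed

text \<open>The number of cosets of \<open>S\<close> in \<open>U\<close> is prime to
  \<open>p\<close>, so \<open>Q\<close> fixes one of them, say \<open>S #> g\<close>; then
  \<open>g\<close> conjugates \<open>Q\<close> into \<open>S\<close>.\<close>

lemma p_subgroup_conj_sylow:
  assumes "subgroup U G" "sylow_in U S" "p_subgroup Q" "Q \<subseteq> U"
  obtains g where "g \<in> U" "cj g ` Q \<subseteq> S"
proof -
  interpret U: finite_group_prime "G\<lparr>carrier := U\<rparr>" p by (rule finite_group_prime_restrict[OF assms(1)])
  have S: "subgroup S G" "S \<subseteq> U" "card S = p ^ multiplicity p (card U)"
    using assms(2) by (auto simp: sylow_in_def)
  obtain k where Q: "subgroup Q G" "card Q = p ^ k" using assms(3) by (auto simp: p_subgroup_def)
  have SU: "subgroup S (G\<lparr>carrier := U\<rparr>)" and QU: "subgroup Q (G\<lparr>carrier := U\<rparr>)"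
    using subgroup_incl assms Q S by blast+
  let ?R = "rcosets\<^bsub>G\<lparr>carrier := U\<rparr>\<^esub> S"
  let ?F = "{c \<in> ?R. \<forall>q\<in>Q. c #> q = c}"
  have "card ?R * p ^ multiplicity p (card U) = card U"
    using U.lagrange[OF SU] S(3) by (simp add: order_def)
  moreover have "\<not> p ^ Suc (multiplicity p (card U)) dvd card U"
    using card_subgroup_pos[OF assms(1)] p_gt_1 multiplicity_geI[of "card U" p "Suc (multiplicity p (card U))"] by auto
  ultimately have "\<not> p dvd card ?R" by (metis mult_dvd_mono dvd_refl power_Suc)
  then have "\<not> p dvd card ?F"
    using U.card_fixed_rcosets[OF SU QU Q(2)] by (simp add: dvd_eq_mod_eq_0)
  then have "?F \<noteq> {}" by (metis card.empty dvd_0_right)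
  then obtain c where c: "c \<in> ?F" by blast
  then obtain g where g: "g \<in> U" "c = S #> g" by (auto simp: RCOSETS_def)
  have gG: "g \<in> carrier G" using g assms(1) subgroup.mem_carrier by metis
  have "cj g q \<in> S" if "q \<in> Q" for q
    using rcoset_fixed_imp[OF S(1) gG, of q] that c g(2) subgroup.mem_carrier[OF Q(1)] by auto
  then show ?thesis using that g(1) by blast
qed

lemma subgroup_cj_subset:
  assumes "subgroup U G" "g \<in> U" "K \<subseteq> U"
  shows "cj g ` K \<subseteq> U"
  using assms subgroup.m_closed subgroup.m_inv_closed by (fastforce simp: cj_def)

lemma sylow_in_cj:
  assumes "subgroup U G" "sylow_in U S" "g \<in> U"
  shows "sylow_in U (cj g ` S)"
proof -
  have "g \<in> carrier G" using assms subgroup.mem_carrier by metis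
  then show ?thesis
    using assms subgroup_cj[of S g] cj_image_card[of g S] subgroup_cj_subset[OF assms(1,3), of S]
    by (auto simp: sylow_in_def subgroup.subset)
qed

lemma sylow_in_p_subgroup: "sylow_in U S \<Longrightarrow> p_subgroup S"
  by (auto simp: sylow_in_def p_subgroup_def)

lemma p_subgroup_in_sylow:
  assumes "subgroup U G" "p_subgroup Q" "Q \<subseteq> U"
  obtains S where "sylow_in U S" "Q \<subseteq> S"
proof -
  obtain S where S: "sylow_in U S" using sylow_in_exists[OF assms(1)] .
  obtain g where g: "g \<in> U" "cj g ` Q \<subseteq> S" using p_subgroup_conj_sylow[OF assms(1) S assms(2,3)] .
  have gG: "g \<in> carrier G" "Q \<subseteq> carrier G"
    using g(1) assms(3) subgroup.subset[OF assms(1)] by auto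
  have "cj (inv g) ` cj g ` Q \<subseteq> cj (inv g) ` S" using g(2) by blast
  then have "Q \<subseteq> cj (inv g) ` S" using cj_image_cancel(2)[OF gG] by simp
  moreover have "sylow_in U (cj (inv g) ` S)"
    using sylow_in_cj[OF assms(1) S subgroup.m_inv_closed[OF assms(1) g(1)]] .
  ultimately show ?thesis using that by blast
qed

lemma sylow_in_conj:
  assumes "subgroup U G" "sylow_in U S" "sylow_in U T"
  obtains g where "g \<in> U" "cj g ` S = T"
proof -
  obtain g where g: "g \<in> U" "cj g ` S \<subseteq> T"
    using p_subgroup_conj_sylow[OF assms(1,3) sylow_in_p_subgroup[OF assms(2)]] assms(2)
    by (auto simp: sylow_in_def)
  have "card (cj g ` S) = card T"
    using sylow_in_cj[OF assms(1,2) g(1)] assms(3) by (simp add: sylow_in_def)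
  then have "cj g ` S = T"
    using g(2) card_subset_eq[of T] finite_subgroup assms(3) by (auto simp: sylow_in_def)
  then show ?thesis using that g(1) by blast
qed

end

section \<open>Frobenius' criterion\<close>

lemma roots_of_unity_coprime:
  fixes z :: complex
  assumes "z ^ m = 1" "z ^ p = 1" "coprime p m"
  shows "z = 1"
proof (cases "m = 0")
  case True
  then show ?thesis using assms by simp
next
  case False
  then obtain a b where "m * a = p * b + 1"
    using bezout_nat[of m p] assms(3) by (auto simp: coprime_commute gcd.commute)
  then have "(z ^ m) ^ a = (z ^ p) ^ b * z" by (simp flip: power_mult power_add power_Suc2)
  then show ?thesis using assms by simp
qed

lemma multiplicity_ge_nat:
  fixes q m :: nat
  shows "\<lbrakk>Factorial_Ring.prime q; 0 < m; q ^ n dvd m\<rbrakk> \<Longrightarrow> n \<le> multiplicity q m"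
  using multiplicity_geI[of m q n] by (simp add: prime_nat_iff)

section \<open>Regular elements and the structure of normalizers\<close>

context finite_group_prime
begin

definition p_reg :: "'a \<Rightarrow> bool" where
  "p_reg x \<longleftrightarrow> x \<in> carrier G \<and> coprime p (ord x)"

text \<open>Equivalently, the quotient of normalizer by centralizer is a \<open>p\<close>-group for
  every \<open>p\<close>-subgroup. Stated for elements, the condition passes to subgroups of
  \<open>G\<close> without quotient groups.\<close>

definition frobenius_condition :: bool where
  "frobenius_condition \<longleftrightarrow>
     (\<forall>K x. p_subgroup K \<and> p_reg x \<and> x \<in> norm_of K \<longrightarrow> x \<in> cent_of K)"

lemma p_regI: "\<lbrakk>x \<in> carrier G; x [^] (m::nat) = \<one>; coprime p m\<rbrakk> \<Longrightarrow> p_reg x"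
  unfolding p_reg_def by (meson coprime_divisors dvd_refl pow_eq_id)

lemma p_reg_iff: "p_reg x \<longleftrightarrow> x \<in> carrier G \<and> (\<exists>m::nat. x [^] m = \<one> \<and> coprime p m)"
  using p_regI pow_ord_eq_1 p_reg_def by blast

lemma p_reg_cj: "\<lbrakk>p_reg x; g \<in> carrier G\<rbrakk> \<Longrightarrow> p_reg (cj g x)"
  unfolding p_reg_iff by (metis cj_closed cj_pow cj_one(1))

lemma p_reg_restrict:
  assumes "subgroup U G"
  shows "finite_group_prime.p_reg (G\<lparr>carrier := U\<rparr>) p x \<longleftrightarrow> x \<in> U \<and> p_reg x"
proof -
  interpret U: finite_group_prime "G\<lparr>carrier := U\<rparr>" p by (rule finite_group_prime_restrict[OF assms])
  show ?thesis unfolding p_reg_iff U.p_reg_iff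
    using subgroup.mem_carrier[OF assms] by (auto simp flip: nat_pow_consistent)
qed

text \<open>For \<open>q \<noteq> p\<close> the elements of a Sylow \<open>q\<close>-subgroup of
  \<open>U\<close> are \<open>p\<close>-regular, so it lies in \<open>Y\<close>.\<close>

lemma multiplicity_p_reg:
  assumes "subgroup U G" "subgroup Y G" "\<And>x. \<lbrakk>x \<in> U; p_reg x\<rbrakk> \<Longrightarrow> x \<in> Y"
    and "Factorial_Ring.prime q" "q \<noteq> p"
  shows "multiplicity q (card U) \<le> multiplicity q (card Y)"
proof -
  interpret q: finite_group_prime G q
    using assms(4) finite_carrier by (simp add: finite_group_prime_def finite_group_prime_axioms_def is_group)
  obtain T where T: "q.sylow_in U T" using q.sylow_in_exists[OF assms(1)] .
  have "T \<subseteq> Y"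
  proof
    fix x assume x: "x \<in> T"
    obtain n where "x [^] (q ^ n) = \<one>"
      using q.p_subgroup_exponent[OF q.sylow_in_p_subgroup[OF T]] x by blast
    moreover have "coprime p (q ^ n)" using assms(4,5) prime_p by (simp add: primes_coprime)
    moreover have "x \<in> U" using T x by (auto simp: q.sylow_in_def)
    ultimately show "x \<in> Y" using assms(3) p_regI subgroup.mem_carrier[OF assms(1)] by blast
  qed
  then have "q ^ multiplicity q (card U) dvd card Y"
    using card_subgroup_dvd[of T Y] assms(2) T by (simp add: q.sylow_in_def)
  then show ?thesis using multiplicity_ge_nat card_subgroup_pos[OF assms(2)] assms(4) by blast
qed

text \<open>Orders are compared prime by prime: \<open>S\<close> accounts for \<open>p\<close>, and
  \<open>multiplicity_p_reg\<close> for all other primes.\<close>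

lemma eq_if_sylow_p_reg:
  assumes "subgroup U G" "subgroup Y G" "Y \<subseteq> U" "sylow_in U S" "S \<subseteq> Y"
    and "\<And>x. \<lbrakk>x \<in> U; p_reg x\<rbrakk> \<Longrightarrow> x \<in> Y"
  shows "Y = U"
proof -
  have "card U dvd card Y"
  proof (rule multiplicity_le_imp_dvd)
    show "card U \<noteq> 0" using card_subgroup_pos[OF assms(1)] by simp
    fix q :: nat assume q: "Factorial_Ring.prime q"
    show "multiplicity q (card U) \<le> multiplicity q (card Y)"
    proof (cases "q = p")
      case True
      have "p ^ multiplicity p (card U) dvd card Y"
        using card_subgroup_dvd[of S Y] assms(2,4,5) by (simp add: sylow_in_def)
      then show ?thesis using True multiplicity_ge_nat card_subgroup_pos[OF assms(2)] prime_p by blast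
    next
      case False
      then show ?thesis using multiplicity_p_reg[OF assms(1,2,6) q] by blast
    qed
  qed
  then have "card U \<le> card Y" using card_subgroup_pos[OF assms(2)] dvd_imp_le by blast
  then show ?thesis using assms(3) card_seteq finite_subgroup[OF assms(1)] by blast
qed

text \<open>The products form a subgroup because \<open>cent_of D\<close> is normal in
  \<open>norm_of D\<close>. It contains \<open>S\<close> and, by Frobenius' condition, all
  \<open>p\<close>-regular elements of \<open>norm_of D\<close>, so \<open>eq_if_sylow_p_reg\<close>
  applies.\<close>

lemma norm_of_decompose:
  assumes "frobenius_condition" "p_subgroup D" "sylow_in (norm_of D) S" "n \<in> norm_of D"
  obtains c s where "c \<in> cent_of D" "s \<in> S" "n = c \<otimes> s"
proof -
  let ?Y = "{c \<otimes> s |c s. c \<in> cent_of D \<and> s \<in> S}"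
  have D: "D \<subseteq> carrier G" using assms(2) subgroup.subset by (auto simp: p_subgroup_def)
  interpret S: subgroup S G using assms(3) by (simp add: sylow_in_def)
  interpret C: subgroup "cent_of D" G using cent_of_subgroup[OF D] .
  interpret N: subgroup "norm_of D" G using norm_of_subgroup[OF D] .
  have SN: "S \<subseteq> norm_of D" using assms(3) by (simp add: sylow_in_def)
  have Y: "subgroup ?Y G"
  proof (rule subgroup_finiteI[OF finite_carrier])
    show "?Y \<subseteq> carrier G" by auto
    have "\<one> = \<one> \<otimes> \<one>" by simp
    then show "\<one> \<in> ?Y" using S.one_closed C.one_closed by blast
    fix x y assume "x \<in> ?Y" "y \<in> ?Y"
    then obtain c s d t where c: "c \<in> cent_of D" "s \<in> S" "x = c \<otimes> s"
      and d: "d \<in> cent_of D" "t \<in> S" "y = d \<otimes> t" by blast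
    have "x \<otimes> y = (c \<otimes> cj s d) \<otimes> (s \<otimes> t)"
      using c d by (simp add: cj_def m_assoc)
    moreover have "c \<otimes> cj s d \<in> cent_of D" using cent_of_cj[OF D _ d(1)] c SN by blast
    ultimately show "x \<otimes> y \<in> ?Y" using c d by blast
  qed
  have "?Y = norm_of D"
  proof (rule eq_if_sylow_p_reg[OF N.subgroup_axioms Y _ assms(3)])
    show "?Y \<subseteq> norm_of D" using SN cent_of_subset_norm_of[OF D] by blast
    show "S \<subseteq> ?Y"
    proof
      fix s assume s: "s \<in> S"
      then have "s = \<one> \<otimes> s" by simp
      then show "s \<in> ?Y" using s C.one_closed by blast
    qed
    fix x assume "x \<in> norm_of D" "p_reg x"
    then have "x \<in> cent_of D" using assms(1,2) by (simp add: frobenius_condition_def)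
    moreover from this have "x = x \<otimes> \<one>" by simp
    ultimately show "x \<in> ?Y" using S.one_closed by blast
  qed
  then show ?thesis using assms(4) that by blast
qed

section \<open>Control of fusion and the transfer\<close>

lemma p_subgroup_inter_norm_of:
  assumes "p_subgroup S" "p_subgroup T" "S \<inter> T \<noteq> S"
  shows "p_subgroup (S \<inter> norm_of (S \<inter> T))" "S \<inter> T \<subset> S \<inter> norm_of (S \<inter> T)"
proof -
  have sub: "subgroup S G" "subgroup (S \<inter> T) G"
    using assms subgroups_Inter_pair by (auto simp: p_subgroup_def)
  then have "subgroup (S \<inter> norm_of (S \<inter> T)) G"
    using subgroups_Inter_pair norm_of_subgroup subgroup.subset by metis
  then show "p_subgroup (S \<inter> norm_of (S \<inter> T))" using p_subgroup_subset[OF assms(1)] by blast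
  obtain g where "g \<in> S" "g \<notin> S \<inter> T" "g \<in> norm_of (S \<inter> T)"
    using normalizer_grows[OF assms(1) sub(2)] assms(3) by blast
  then show "S \<inter> T \<subset> S \<inter> norm_of (S \<inter> T)" using subgroup_subset_norm_of[OF sub(2)] by blast
qed

text \<open>Induction from large intersections \<open>D\<close> to small ones. Normalizers grow, so
  \<open>S\<close> and \<open>T\<close> both meet \<open>norm_of D\<close> in more than
  \<open>D\<close>. A Sylow subgroup \<open>U\<close> of \<open>G\<close> above a Sylow subgroup
  \<open>S1\<close> of \<open>norm_of D\<close> serves as a bridge: \<open>S\<close> meets
  \<open>U\<close>, and \<open>T\<close> meets a conjugate of \<open>U\<close> by some
  \<open>c\<close> centralizing \<open>D\<close>, in more than \<open>D\<close>. The induction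
  hypothesis for both pairs gives \<open>a\<close> and \<open>b\<close>, and the composite of
  \<open>a\<close>, \<open>c\<close> and \<open>b\<close> still centralizes
  \<open>D\<close>.\<close>

lemma sylow_conj_cent_of:
  assumes "frobenius_condition" "sylow_in (carrier G) S" "sylow_in (carrier G) T"
  shows "\<exists>c \<in> cent_of (S \<inter> T). cj c ` S = T"
  using assms(2,3)
proof (induction "card S - card (S \<inter> T)" arbitrary: S T rule: less_induct)
  case less
  let ?n = "p ^ multiplicity p (card (carrier G))"
  have card: "card U = ?n" "subgroup U G" "U \<subseteq> carrier G" "finite U" if "sylow_in (carrier G) U" for U
    using that finite_subgroup by (auto simp: sylow_in_def)
  have S: "p_subgroup S" and T: "p_subgroup T" using less.prems sylow_in_p_subgroup by auto
  show ?case
  proof (cases "S \<inter> T = S")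
    case True
    then have "S = T" using card[OF less.prems(1)] card[OF less.prems(2)] card_subset_eq[of T S] by auto
    moreover have "\<one> \<in> cent_of (S \<inter> T)"
      using cent_of_subgroup card(3)[OF less.prems(1)] subgroup.one_closed by blast
    moreover have "cj \<one> ` S = S" using cj_image_one card(3)[OF less.prems(1)] by blast
    ultimately show ?thesis by blast
  next
    case False
    define D where "D = S \<inter> T"
    have "T \<inter> S \<noteq> T"
    proof
      assume "T \<inter> S = T"
      then have "T = S" using card[OF less.prems(1)] card[OF less.prems(2)] card_subset_eq[of S T] by auto
      then show False using False by blast
    qed
    then have NT: "p_subgroup (T \<inter> norm_of D)" "D \<subset> T \<inter> norm_of D"
      using p_subgroup_inter_norm_of[OF T S] by (simp_all add: D_def Int_commute)
    have NS: "p_subgroup (S \<inter> norm_of D)" "D \<subset> S \<inter> norm_of D"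
      using p_subgroup_inter_norm_of[OF S T] False by (simp_all add: D_def)
    have Dsub: "subgroup D G" "D \<subseteq> carrier G"
      using card[OF less.prems(1)] card[OF less.prems(2)] subgroups_Inter_pair by (auto simp: D_def)
    have Dp: "p_subgroup D" using p_subgroup_subset[OF S Dsub(1)] by (simp add: D_def)
    have N: "subgroup (norm_of D) G" using norm_of_subgroup[OF Dsub(2)] .
    interpret C: subgroup "cent_of D" G using cent_of_subgroup[OF Dsub(2)] .
    obtain S1 where S1: "sylow_in (norm_of D) S1" "S \<inter> norm_of D \<subseteq> S1"
      using p_subgroup_in_sylow[OF N NS(1)] by blast
    have "subgroup S1 G" using S1(1) by (simp add: sylow_in_def)
    then have S1sub: "subgroup S1 G" "S1 \<subseteq> carrier G" using subgroup.subset by auto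
    obtain U where U: "sylow_in (carrier G) U" "S1 \<subseteq> U"
      using p_subgroup_in_sylow[OF subgroup_self sylow_in_p_subgroup[OF S1(1)] S1sub(2)] .
    obtain n where n: "n \<in> norm_of D" "cj n ` (T \<inter> norm_of D) \<subseteq> S1"
      using p_subgroup_conj_sylow[OF N S1(1) NT(1)] by blast
    have nG: "n \<in> carrier G" using n(1) by (simp add: norm_of_def)
    have "inv n \<in> norm_of D" using n(1) N subgroup.m_inv_closed by metis
    then obtain c s where cs: "c \<in> cent_of D" "s \<in> S1" "inv n = c \<otimes> s"
      using norm_of_decompose[OF assms(1) Dp S1(1)] by blast
    have cG: "c \<in> carrier G" and sG: "s \<in> carrier G" using cs S1sub by auto
    \<comment> \<open>\<open>n\<close> need not centralize \<open>D\<close>, but the factor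
      \<open>s\<close> of its inverse normalizes \<open>S1\<close> and drops out, which leaves the
      conjugation by \<open>c\<close>.\<close>
    have TN: "T \<inter> norm_of D \<subseteq> cj c ` U"
    proof -
      have "T \<inter> norm_of D = cj (inv n) ` cj n ` (T \<inter> norm_of D)"
        using cj_image_cancel(2)[OF nG] N subgroup.subset by (metis inf.coboundedI2)
      also have "\<dots> \<subseteq> cj (inv n) ` S1" using n(2) by blast
      also have "\<dots> = cj c ` cj s ` S1" using cs(3) cj_image_comp[OF cG sG S1sub(2)] by simp
      also have "cj s ` S1 = S1" using subgroup_subset_norm_of[OF S1sub(1)] cs(2) by (auto simp: norm_of_def)
      finally show ?thesis using U(2) by blast
    qed
    have cU: "sylow_in (carrier G) (cj c ` U)" using sylow_in_cj[OF subgroup_self U(1) cG] .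
    have "D \<subset> S \<inter> U" using NS(2) S1(2) U(2) by blast
    then have "card D < card (S \<inter> U)" "card (S \<inter> U) \<le> card S"
      using card(4)[OF less.prems(1)] psubset_card_mono[of "S \<inter> U" D] card_mono[of S "S \<inter> U"] by auto
    then have "card S - card (S \<inter> U) < card S - card (S \<inter> T)" unfolding D_def by linarith
    then obtain a where a: "a \<in> cent_of (S \<inter> U)" "cj a ` S = U"
      using less.hyps[OF _ less.prems(1) U(1)] by blast
    have "D \<subset> cj c ` U \<inter> T" using NT(2) TN by blast
    then have "card D < card (cj c ` U \<inter> T)" "card (cj c ` U \<inter> T) \<le> card (cj c ` U)" "card (cj c ` U) = card S"
      using card[OF cU] card[OF less.prems(1)] psubset_card_mono[of "cj c ` U \<inter> T" D] card_mono[of "cj c ` U" "cj c ` U \<inter> T"] by auto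
    then have "card (cj c ` U) - card (cj c ` U \<inter> T) < card S - card (S \<inter> T)" unfolding D_def by linarith
    then obtain b where b: "b \<in> cent_of (cj c ` U \<inter> T)" "cj b ` cj c ` U = T"
      using less.hyps[OF _ cU less.prems(2)] by blast
    have aD: "a \<in> cent_of D" using a(1) cent_of_antimono \<open>D \<subset> S \<inter> U\<close> by blast
    have bD: "b \<in> cent_of D" using b(1) cent_of_antimono \<open>D \<subset> cj c ` U \<inter> T\<close> by blast
    have "cj (b \<otimes> (c \<otimes> a)) ` S = cj b ` cj c ` cj a ` S"
      using aD bD cG card(3)[OF less.prems(1)] by (simp add: cj_image_comp)
    also have "\<dots> = T" using a b by simp
    finally have "cj (b \<otimes> (c \<otimes> a)) ` S = T" .
    moreover have "b \<otimes> (c \<otimes> a) \<in> cent_of D" using aD bD cs(1) by simp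
    ultimately show ?thesis unfolding D_def by blast
  qed
qed

text \<open>\<open>S\<close> and its conjugate by \<open>g\<close> share the element
  \<open>cj g x\<close>. A \<open>c\<close> centralizing their intersection carries the conjugate
  back to \<open>S\<close>, so \<open>c \<otimes> g\<close> normalizes \<open>S\<close> and still
  sends \<open>x\<close> to \<open>cj g x\<close>. By \<open>norm_of_decompose\<close> it acts on
  \<open>S\<close> like an element of \<open>S\<close>.\<close>

lemma sylow_controls_fusion:
  assumes "frobenius_condition" "sylow_in (carrier G) S"
    and "x \<in> S" "g \<in> carrier G" "cj g x \<in> S"
  obtains s where "s \<in> S" "cj s x = cj g x"
proof -
  interpret S: subgroup S G using assms(2) by (simp add: sylow_in_def)
  have gS: "sylow_in (carrier G) (cj g ` S)" using sylow_in_cj[OF subgroup_self assms(2,4)] .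
  obtain c where c: "c \<in> cent_of (cj g ` S \<inter> S)" "cj c ` cj g ` S = S"
    using sylow_conj_cent_of[OF assms(1) gS assms(2)] by blast
  have cG: "c \<in> carrier G" using c(1) by (simp add: cent_of_def)
  have "c \<otimes> g \<in> norm_of S" using c(2) cG assms(4) cj_image_comp[OF cG assms(4) S.subset] by (simp add: norm_of_def)
  moreover have "sylow_in (norm_of S) S"
  proof -
    have N: "subgroup (norm_of S) G" using norm_of_subgroup[OF S.subset] .
    have SN: "S \<subseteq> norm_of S" using subgroup_subset_norm_of[OF S.subgroup_axioms] .
    have "card S dvd card (norm_of S)" "card (norm_of S) dvd card (carrier G)"
      using card_subgroup_dvd S.subgroup_axioms N SN subgroup_self subgroup.subset by metis+
    then have "multiplicity p (card (carrier G)) \<le> multiplicity p (card (norm_of S))"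
      "multiplicity p (card (norm_of S)) \<le> multiplicity p (card (carrier G))"
      using assms(2) multiplicity_ge_nat[OF prime_p card_subgroup_pos[OF N]]
        dvd_imp_multiplicity_le[of "card (norm_of S)" "card (carrier G)" p] card_subgroup_pos[OF subgroup_self] p_gt_1
      by (auto simp: sylow_in_def)
    then show ?thesis using assms(2) SN by (simp add: sylow_in_def)
  qed
  ultimately obtain d s where ds: "d \<in> cent_of S" "s \<in> S" "c \<otimes> g = d \<otimes> s"
    using norm_of_decompose[OF assms(1) sylow_in_p_subgroup[OF assms(2)]] by blast
  have dG: "d \<in> carrier G" using ds(1) by (simp add: cent_of_def)
  have xG: "x \<in> carrier G" using assms(3) by simp
  have "cj g x = cj c (cj g x)" using c(1) assms(3,5) by (auto simp: cent_of_def)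
  also have "\<dots> = cj (c \<otimes> g) x" using cG assms(4) xG by (simp add: cj_comp)
  also have "\<dots> = cj d (cj s x)" using ds dG xG by (simp add: cj_comp)
  also have "\<dots> = cj s x"
  proof -
    have "cj s x \<in> S" using ds(2) assms(3) by (simp add: cj_def)
    then show ?thesis using ds(1) by (auto simp: cent_of_def)
  qed
  finally show ?thesis using that ds(2) by simp
qed

text \<open>A character of \<open>S\<close> that is constant on the fusion classes extends to a function
  \<open>\<Phi>\<close> on \<open>G\<close> that is equivariant under multiplication by \<open>S\<close> on both sides: put
  \<open>\<Phi> (h t u) = \<chi> h * \<chi> u\<close> for a representative \<open>t\<close> of each double coset. The transfer is
  then the product of \<open>\<Phi> (x g) / \<Phi> x\<close> over the cosets \<open>S x\<close>, and no choice of
  representatives enters.\<close>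

lemma biequivariant_extension:
  fixes \<chi> :: "'a \<Rightarrow> complex"
  assumes "subgroup S G"
    and hom: "\<And>x y. \<lbrakk>x \<in> S; y \<in> S\<rbrakk> \<Longrightarrow> \<chi> (x \<otimes> y) = \<chi> x * \<chi> y"
    and stable: "\<And>x g. \<lbrakk>x \<in> S; g \<in> carrier G; cj g x \<in> S\<rbrakk> \<Longrightarrow> \<chi> (cj g x) = \<chi> x"
    and chi_p: "\<And>x. x \<in> S \<Longrightarrow> \<chi> x ^ p = 1"
  obtains \<Phi> :: "'a \<Rightarrow> complex" where
    "\<And>s g. \<lbrakk>s \<in> S; g \<in> carrier G\<rbrakk> \<Longrightarrow> \<Phi> (s \<otimes> g) = \<chi> s * \<Phi> g"
    "\<And>s g. \<lbrakk>s \<in> S; g \<in> carrier G\<rbrakk> \<Longrightarrow> \<Phi> (g \<otimes> s) = \<Phi> g * \<chi> s"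
    "\<And>g. g \<in> carrier G \<Longrightarrow> \<Phi> g ^ p = 1"
proof -
  interpret S: subgroup S G by fact
  define DC where "DC g = {h \<otimes> g \<otimes> u |h u. h \<in> S \<and> u \<in> S}" for g
  \<comment> \<open>The representative is chosen from the double coset as a set, so
    \<open>DC_eq\<close> makes it constant on double cosets.\<close>
  define t where "t g = (SOME x. x \<in> DC g)" for g
  have DC_sub: "DC (s \<otimes> g \<otimes> r) \<subseteq> DC g" if g: "g \<in> carrier G" and s: "s \<in> S" "r \<in> S" for g s r
  proof
    fix x assume "x \<in> DC (s \<otimes> g \<otimes> r)"
    then obtain h u where h: "h \<in> S" "u \<in> S" "x = h \<otimes> (s \<otimes> g \<otimes> r) \<otimes> u" by (auto simp: DC_def)
    then have "x = (h \<otimes> s) \<otimes> g \<otimes> (r \<otimes> u)" using g s by (simp add: m_assoc)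
    moreover have "h \<otimes> s \<in> S" "r \<otimes> u \<in> S" using h s by auto
    ultimately show "x \<in> DC g" by (auto simp: DC_def)
  qed
  have DC_eq: "DC (s \<otimes> g \<otimes> r) = DC g" if g: "g \<in> carrier G" and s: "s \<in> S" "r \<in> S" for g s r
  proof -
    have "inv s \<otimes> (s \<otimes> g \<otimes> r) \<otimes> inv r = g" using g s by (simp add: m_assoc)
    then show ?thesis
      using DC_sub[OF g s] DC_sub[of "s \<otimes> g \<otimes> r" "inv s" "inv r"] g s by auto
  qed
  have "\<exists>h u. h \<in> S \<and> u \<in> S \<and> g = h \<otimes> t g \<otimes> u \<and> t g \<in> carrier G" if g: "g \<in> carrier G" for g
  proof -
    have "g = \<one> \<otimes> g \<otimes> \<one>" using g by simp
    then have "g \<in> DC g" unfolding DC_def using S.one_closed by blast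
    then have "t g \<in> DC g" unfolding t_def by (rule someI)
    then obtain h u where h: "h \<in> S" "u \<in> S" "t g = h \<otimes> g \<otimes> u" by (auto simp: DC_def)
    then have "g = inv h \<otimes> t g \<otimes> inv u" using g by (simp add: m_assoc)
    moreover have "t g \<in> carrier G" using h g by simp
    ultimately show ?thesis using h by blast
  qed
  then obtain h u where hu: "\<And>g. g \<in> carrier G \<Longrightarrow> h g \<in> S \<and> u g \<in> S \<and> g = h g \<otimes> t g \<otimes> u g \<and> t g \<in> carrier G"
    by metis
  define \<Phi> where "\<Phi> g = \<chi> (h g) * \<chi> (u g)" for g
  \<comment> \<open>Two factorizations through \<open>x\<close> differ by a pair of elements of
    \<open>S\<close> that are conjugate under \<open>x\<close>, on which \<open>\<chi>\<close>
    agrees by \<open>stable\<close>.\<close>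
  have wd: "\<chi> a * \<chi> b = \<chi> a' * \<chi> b'"
    if S: "a \<in> S" "b \<in> S" "a' \<in> S" "b' \<in> S" and x: "x \<in> carrier G" and eq: "a \<otimes> x \<otimes> b = a' \<otimes> x \<otimes> b'" for a b a' b' x
  proof -
    have "cj x (b' \<otimes> inv b) = inv a' \<otimes> (a' \<otimes> x \<otimes> b') \<otimes> inv b \<otimes> inv x"
      using S x by (simp add: cj_def m_assoc)
    also have "\<dots> = inv a' \<otimes> a" using S x by (simp add: m_assoc flip: eq)
    finally have e: "cj x (b' \<otimes> inv b) = inv a' \<otimes> a" .
    have "\<chi> a = \<chi> (a' \<otimes> (inv a' \<otimes> a))" using S by simp
    also have "\<dots> = \<chi> a' * \<chi> (inv a' \<otimes> a)" using S hom[of a' "inv a' \<otimes> a"] by simp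
    also have "\<chi> (inv a' \<otimes> a) = \<chi> (b' \<otimes> inv b)" using stable[of "b' \<otimes> inv b" x] S x e by simp
    finally have "\<chi> a * \<chi> b = \<chi> a' * (\<chi> (b' \<otimes> inv b) * \<chi> b)" by simp
    also have "\<chi> (b' \<otimes> inv b) * \<chi> b = \<chi> (b' \<otimes> inv b \<otimes> b)" using S hom[of "b' \<otimes> inv b" b] by simp
    also have "b' \<otimes> inv b \<otimes> b = b'" using S by (simp add: m_assoc)
    finally show ?thesis .
  qed
  have equiv: "\<Phi> (s \<otimes> g \<otimes> r) = \<chi> s * \<Phi> g * \<chi> r" if g: "g \<in> carrier G" and s: "s \<in> S" "r \<in> S" for g s r
  proof -
    let ?g = "s \<otimes> g \<otimes> r"
    have gG: "?g \<in> carrier G" using g s by simp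
    have t: "t ?g = t g" using DC_eq[OF g s] by (simp add: t_def)
    have "s \<otimes> (h g \<otimes> t g \<otimes> u g) \<otimes> r = s \<otimes> h g \<otimes> t g \<otimes> (u g \<otimes> r)"
    proof -
      have "h g \<in> carrier G" "u g \<in> carrier G" "t g \<in> carrier G" "s \<in> carrier G" "r \<in> carrier G"
        using hu[OF g] s by auto
      then show ?thesis by (simp add: m_assoc)
    qed
    then have "h ?g \<otimes> t g \<otimes> u ?g = (s \<otimes> h g) \<otimes> t g \<otimes> (u g \<otimes> r)"
      using hu[OF g] hu[OF gG] t by metis
    then have "\<chi> (h ?g) * \<chi> (u ?g) = \<chi> (s \<otimes> h g) * \<chi> (u g \<otimes> r)"
      using wd[of "h ?g" "u ?g" "s \<otimes> h g" "u g \<otimes> r" "t g"] hu[OF g] hu[OF gG] s by blast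
    then show ?thesis using hom s hu[OF g] by (simp add: \<Phi>_def)
  qed
  have one: "\<chi> \<one> = 1"
  proof -
    have "\<chi> \<one> * \<chi> \<one> = \<chi> \<one>" using hom[of \<one> \<one>] S.one_closed by simp
    moreover have "\<chi> \<one> \<noteq> 0" using chi_p[OF S.one_closed] p_gt_1 by (metis zero_neq_one power_0_left less_numeral_extra(1) not_one_less_zero)
    ultimately show ?thesis by simp
  qed
  show thesis
  proof (rule that[of \<Phi>])
    fix s g assume s: "s \<in> S" and g: "g \<in> carrier G"
    show "\<Phi> (s \<otimes> g) = \<chi> s * \<Phi> g" using equiv[OF g s S.one_closed] one g s by simp
    show "\<Phi> (g \<otimes> s) = \<Phi> g * \<chi> s" using equiv[OF g S.one_closed s] one g s by simp
  next
    fix g assume "g \<in> carrier G"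
    then show "\<Phi> g ^ p = 1" using hu chi_p by (simp add: \<Phi>_def power_mult_distrib)
  qed
qed

text \<open>Multiplicativity is a reindexing of the cosets by right multiplication. On
  \<open>S\<close> every factor of the product equals \<open>\<chi> x\<close> by right equivariance,
  so the value is found without following the cycles of \<open>x\<close> on the cosets.\<close>

lemma transfer:
  fixes \<chi> :: "'a \<Rightarrow> complex"
  assumes "subgroup S G"
    and "\<And>x y. \<lbrakk>x \<in> S; y \<in> S\<rbrakk> \<Longrightarrow> \<chi> (x \<otimes> y) = \<chi> x * \<chi> y"
    and "\<And>x g. \<lbrakk>x \<in> S; g \<in> carrier G; cj g x \<in> S\<rbrakk> \<Longrightarrow> \<chi> (cj g x) = \<chi> x"
    and "\<And>x. x \<in> S \<Longrightarrow> \<chi> x ^ p = 1"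
  obtains V :: "'a \<Rightarrow> complex" where
    "\<And>x y. \<lbrakk>x \<in> carrier G; y \<in> carrier G\<rbrakk> \<Longrightarrow> V (x \<otimes> y) = V x * V y"
    "\<And>x. x \<in> carrier G \<Longrightarrow> V x ^ p = 1"
    "\<And>x. x \<in> S \<Longrightarrow> V x = \<chi> x ^ card (rcosets S)"
proof -
  interpret S: subgroup S G by fact
  obtain \<Phi> :: "'a \<Rightarrow> complex" where left: "\<And>s g. \<lbrakk>s \<in> S; g \<in> carrier G\<rbrakk> \<Longrightarrow> \<Phi> (s \<otimes> g) = \<chi> s * \<Phi> g"
    and right: "\<And>s g. \<lbrakk>s \<in> S; g \<in> carrier G\<rbrakk> \<Longrightarrow> \<Phi> (g \<otimes> s) = \<Phi> g * \<chi> s"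
    and Phi_p: "\<And>g. g \<in> carrier G \<Longrightarrow> \<Phi> g ^ p = 1"
    using biequivariant_extension[OF assms] by blast
  have nz: "\<Phi> g \<noteq> 0" if "g \<in> carrier G" for g using Phi_p[OF that] p_gt_1 by (auto simp: power_0_left)
  have chi_nz: "\<chi> s \<noteq> 0" if "s \<in> S" for s using assms(4)[OF that] p_gt_1 by (auto simp: power_0_left)
  define r where "r c = (SOME x. x \<in> c)" for c :: "'a set"
  have r: "r c \<in> c" if "c \<in> rcosets S" for c
    unfolding r_def using S.rcosets_non_empty[OF that] by (simp add: some_in_eq)
  have cG: "c \<subseteq> carrier G" if "c \<in> rcosets S" for c using S.rcosets_carrier[OF group_axioms that] .
  have rG: "r c \<in> carrier G" if "c \<in> rcosets S" for c using r cG that by blast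
  define \<rho> where "\<rho> g c = \<Phi> (r c \<otimes> g) / \<Phi> (r c)" for g c
  \<comment> \<open>Left equivariance cancels the value at \<open>x \<otimes> inv (r c)\<close>, so
    the quotient depends only on the coset.\<close>
  have ratio: "\<Phi> (x \<otimes> g) / \<Phi> x = \<rho> g c" if c: "c \<in> rcosets S" and x: "x \<in> c" and g: "g \<in> carrier G" for x c g
  proof -
    obtain y where y: "y \<in> carrier G" "c = S #> y" using c by (auto simp: RCOSETS_def)
    have s: "x \<otimes> inv (r c) \<in> S" using diff_neutralizes[OF assms(1) c x r[OF c]] .
    have xG: "x \<in> carrier G" using x cG[OF c] by blast
    have "x = (x \<otimes> inv (r c)) \<otimes> r c" using xG rG[OF c] by (simp add: m_assoc)
    moreover have "x \<otimes> g = (x \<otimes> inv (r c)) \<otimes> (r c \<otimes> g)" using xG g rG[OF c] by (simp add: m_assoc)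
    ultimately have "\<Phi> (x \<otimes> g) / \<Phi> x = (\<chi> (x \<otimes> inv (r c)) * \<Phi> (r c \<otimes> g)) / (\<chi> (x \<otimes> inv (r c)) * \<Phi> (r c))"
      using left[OF s rG[OF c]] left[OF s m_closed[OF rG[OF c] g]] by simp
    then show ?thesis using chi_nz[OF s] by (simp add: \<rho>_def)
  qed
  define V where "V g = (\<Prod>c\<in>rcosets S. \<rho> g c)" for g
  show thesis
  proof (rule that[of V])
    fix x y assume x: "x \<in> carrier G" and y: "y \<in> carrier G"
    have closed: "c #> g \<in> rcosets S" if "c \<in> rcosets S" "g \<in> carrier G" for c g
      using that by (auto simp: RCOSETS_def coset_mult_assoc S.subset)
    have bij: "bij_betw (\<lambda>c. c #> x) (rcosets S) (rcosets S)"
      by (rule bij_betw_byWitness[of _ "\<lambda>c. c #> inv x"])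
        (use x closed cG in \<open>auto simp: coset_mult_assoc\<close>)
    have "\<rho> (x \<otimes> y) c = \<rho> y (c #> x) * \<rho> x c" if c: "c \<in> rcosets S" for c
    proof -
      have "r c \<otimes> x \<in> c #> x" using r[OF c] by (auto simp: r_coset_def)
      then have "\<rho> y (c #> x) = \<Phi> (r c \<otimes> x \<otimes> y) / \<Phi> (r c \<otimes> x)"
        using ratio[OF closed[OF c x] _ y] by simp
      then show ?thesis using nz x y rG[OF c] by (simp add: \<rho>_def m_assoc)
    qed
    then have "V (x \<otimes> y) = (\<Prod>c\<in>rcosets S. \<rho> y (c #> x)) * V x"
      by (simp add: V_def prod.distrib)
    also have "(\<Prod>c\<in>rcosets S. \<rho> y (c #> x)) = V y"
      unfolding V_def by (rule prod.reindex_bij_betw[OF bij])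
    finally show "V (x \<otimes> y) = V x * V y" by simp
  next
    fix x assume x: "x \<in> carrier G"
    have "\<rho> x c ^ p = 1" if "c \<in> rcosets S" for c
      using Phi_p rG[OF that] x by (simp add: \<rho>_def power_divide)
    then show "V x ^ p = 1" unfolding V_def prod_power_distrib by simp
  next
    fix x assume x: "x \<in> S"
    have "\<rho> x c = \<chi> x" if "c \<in> rcosets S" for c
      using right[OF x rG[OF that]] nz[OF rG[OF that]] by (simp add: \<rho>_def)
    then show "V x = \<chi> x ^ card (rcosets S)" by (simp add: V_def)
  qed
qed

text \<open>\<open>N\<close> is the kernel of the transfer of a character of \<open>S\<close> whose
  kernel \<open>M\<close> has index \<open>p\<close>. On a \<open>p\<close>-regular element the
  value is a root of unity of order dividing both \<open>p\<close> and a number prime to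
  \<open>p\<close>, hence 1. On \<open>S\<close> the transfer is a power of the character with
  exponent the index of \<open>S\<close>, which is prime to \<open>p\<close>, so \<open>S\<close> is
  not contained in \<open>N\<close>.\<close>

lemma proper_subgroup_p_reg:
  assumes "frobenius_condition" "p dvd order G"
  obtains N where "subgroup N G" "N \<noteq> carrier G" "\<And>x. p_reg x \<Longrightarrow> x \<in> N"
proof -
  obtain S where S: "sylow_in (carrier G) S" using sylow_in_exists[OF subgroup_self] .
  then have Ssub: "subgroup S G" by (simp add: sylow_in_def)
  let ?n = "multiplicity p (order G)"
  have cardS: "card S = p ^ ?n" using S by (simp add: sylow_in_def order_def)
  have "order G > 0" using finite_carrier order_gt_0_iff_finite by blast
  have "?n > 0" using assms(2) \<open>order G > 0\<close> p_gt_1 by (simp add: multiplicity_gt_zero_iff)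
  then obtain l where l: "?n = Suc l" using gr0_implies_Suc by blast
  have triv: "subgroup {\<one>} G" by (rule triv_subgroup)
  obtain M where M: "subgroup M G" "M \<subseteq> S" "card M = p ^ l"
    using p_subgroup_between[OF sylow_in_p_subgroup[OF S] triv, of l] Ssub cardS l p_gt_1 subgroup.one_closed[OF Ssub] by auto
  have cM: "card S = p * card M" using cardS l M by simp
  obtain \<chi> :: "'a \<Rightarrow> complex" where
    chi: "\<And>x y. \<lbrakk>x \<in> S; y \<in> S\<rbrakk> \<Longrightarrow> \<chi> (x \<otimes> y) = \<chi> x * \<chi> y" "\<And>x. x \<in> S \<Longrightarrow> \<chi> x ^ p = 1"
      "\<And>x. x \<in> S \<Longrightarrow> \<chi> x = 1 \<longleftrightarrow> x \<in> M"
    by (rule index_p_character[OF sylow_in_p_subgroup[OF S] M(1,2) cM]) (rule that)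
  have nz: "\<chi> s \<noteq> 0" if "s \<in> S" for s using chi(2)[OF that] p_gt_1 by (auto simp: power_0_left)
  \<comment> \<open>Elements of \<open>S\<close> fused in \<open>G\<close> are already conjugate in
    \<open>S\<close>, and a homomorphism to the complex numbers is constant on the classes of
    \<open>S\<close>.\<close>
  have stable: "\<chi> (cj g x) = \<chi> x" if x: "x \<in> S" and g: "g \<in> carrier G" "cj g x \<in> S" for x g
  proof -
    interpret S: subgroup S G by fact
    obtain s where s: "s \<in> S" "cj s x = cj g x" using sylow_controls_fusion[OF assms(1) S x g] .
    have "\<chi> (cj s x) * \<chi> s = \<chi> (cj s x \<otimes> s)" using chi(1)[of "cj s x" s] s g by simp
    also have "cj s x \<otimes> s = s \<otimes> x" using s(1) x by (simp add: cj_def m_assoc)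
    also have "\<chi> (s \<otimes> x) = \<chi> x * \<chi> s" using chi(1) s x by simp
    finally show ?thesis using nz[OF s(1)] s(2) by simp
  qed
  obtain V :: "'a \<Rightarrow> complex" where
    V: "\<And>x y. \<lbrakk>x \<in> carrier G; y \<in> carrier G\<rbrakk> \<Longrightarrow> V (x \<otimes> y) = V x * V y"
      "\<And>x. x \<in> carrier G \<Longrightarrow> V x ^ p = 1" "\<And>x. x \<in> S \<Longrightarrow> V x = \<chi> x ^ card (rcosets S)"
    using transfer[OF Ssub chi(1) stable chi(2)] by blast
  have V_one: "V \<one> = 1"
  proof -
    have "V \<one> * V \<one> = V \<one>" using V(1)[of \<one> \<one>] by simp
    moreover have "V \<one> \<noteq> 0" using V(2)[of \<one>] p_gt_1 by (auto simp: power_0_left)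
    ultimately show ?thesis by simp
  qed
  have V_pow: "V (x [^] n) = V x ^ n" if "x \<in> carrier G" for x and n :: nat
    by (induction n) (simp_all add: V_one V(1) that)
  define N where "N = {x \<in> carrier G. V x = 1}"
  have "subgroup N G"
    by (rule subgroup_finiteI[OF finite_carrier]) (auto simp: N_def V_one V(1))
  moreover have "x \<in> N" if "p_reg x" for x
  proof -
    have x: "x \<in> carrier G" "coprime p (ord x)" using that by (auto simp: p_reg_def)
    then have "V x ^ ord x = 1" using V_pow[of x "ord x"] V_one by simp
    then show ?thesis using roots_of_unity_coprime[OF _ V(2) x(2)] x(1) by (simp add: N_def)
  qed
  moreover have "N \<noteq> carrier G"
  proof
    assume N: "N = carrier G"
    have "\<not> p ^ Suc ?n dvd order G"
      using multiplicity_ge_nat[OF prime_p \<open>order G > 0\<close>, of "Suc ?n"] by auto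
    then have "\<not> p dvd card (rcosets S)"
      using lagrange[OF Ssub] cardS by (metis mult_dvd_mono dvd_refl power_Suc)
    then have cop: "coprime p (card (rcosets S))" using prime_p prime_imp_coprime by blast
    have "S \<subseteq> M"
    proof
      fix s assume s: "s \<in> S"
      then have "s \<in> N" using subgroup.mem_carrier[OF Ssub] N by blast
      then have "\<chi> s ^ card (rcosets S) = 1" using V(3)[OF s] by (simp add: N_def)
      then show "s \<in> M" using roots_of_unity_coprime[OF _ chi(2)[OF s] cop] chi(3)[OF s] by blast
    qed
    then have "card S \<le> card M" using card_mono finite_subgroup[OF M(1)] by blast
    then show False using cM p_gt_1 card_subgroup_pos[OF M(1)] by simp
  qed
  ultimately show ?thesis using that by blast
qed

lemma frobenius_condition_restrict:
  assumes "frobenius_condition" "subgroup U G"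
  shows "finite_group_prime.frobenius_condition (G\<lparr>carrier := U\<rparr>) p"
proof -
  interpret U: finite_group_prime "G\<lparr>carrier := U\<rparr>" p by (rule finite_group_prime_restrict[OF assms(2)])
  show ?thesis unfolding U.frobenius_condition_def
  proof (intro allI impI)
    fix K x assume *: "U.p_subgroup K \<and> U.p_reg x \<and> x \<in> U.norm_of K"
    then have x: "x \<in> U" "p_reg x" using p_reg_restrict[OF assms(2)] by auto
    have K: "subgroup K (G\<lparr>carrier := U\<rparr>)" using * by (auto simp: U.p_subgroup_def)
    have "p_subgroup K" using * incl_subgroup[OF assms(2) K] by (auto simp: p_subgroup_def U.p_subgroup_def)
    moreover have "x \<in> norm_of K"
      using * x cj_restrict[OF assms(2)] subgroup.mem_carrier[OF assms(2)]
      by (auto simp: norm_of_def U.norm_of_def)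
    ultimately have "x \<in> cent_of K" using assms(1) x(2) by (auto simp: frobenius_condition_def)
    then show "x \<in> U.cent_of K"
      using x cj_restrict[OF assms(2)] by (auto simp: cent_of_def U.cent_of_def)
  qed
qed

end

text \<open>The induction replaces \<open>G\<close> by a proper subgroup, hence the form outside the
  locale. If \<open>p\<close> divides the order, \<open>x\<close> and \<open>y\<close> both lie in
  the subgroup from \<open>proper_subgroup_p_reg\<close>; otherwise all elements are
  \<open>p\<close>-regular.\<close>

theorem frobenius_p_reg_mult:
  assumes "finite_group_prime G p" "finite_group_prime.frobenius_condition G p"
    and "finite_group_prime.p_reg G p x" "finite_group_prime.p_reg G p y"
  shows "finite_group_prime.p_reg G p (x \<otimes>\<^bsub>G\<^esub> y)"
  using assms
proof (induction "card (carrier G)" arbitrary: G rule: less_induct)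
  case less
  interpret finite_group_prime G p by fact
  have xy: "p_reg x" "p_reg y" "x \<in> carrier G" "y \<in> carrier G" using less.prems by (auto simp: p_reg_def)
  show ?case
  proof (cases "p dvd order G")
    case False
    then have "coprime p (order G)" using prime_p prime_imp_coprime by blast
    then show ?thesis using p_regI[of "x \<otimes>\<^bsub>G\<^esub> y" "order G"] xy pow_order_eq_1 by simp
  next
    case True
    obtain N where N: "subgroup N G" "N \<noteq> carrier G" "\<And>x. p_reg x \<Longrightarrow> x \<in> N"
      using proper_subgroup_p_reg[OF less.prems(2) True] by blast
    have "N \<subset> carrier G" using N(1,2) subgroup.subset by blast
    then have "card (carrier (G\<lparr>carrier := N\<rparr>)) < card (carrier G)"
      using finite_carrier psubset_card_mono by simp
    then have "finite_group_prime.p_reg (G\<lparr>carrier := N\<rparr>) p (x \<otimes>\<^bsub>G\<lparr>carrier := N\<rparr>\<^esub> y)"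
      by (rule less.hyps)
        (use finite_group_prime_restrict[OF N(1)] frobenius_condition_restrict[OF less.prems(2) N(1)]
          p_reg_restrict[OF N(1)] N(3) xy in auto)
    then show ?thesis using p_reg_restrict[OF N(1)] by simp
  qed
qed

context finite_group_prime
begin

text \<open>The complement is the set of all \<open>p\<close>-regular elements. An element of its
  Sylow \<open>p\<close>-subgroup has order both a power of \<open>p\<close> and prime to
  \<open>p\<close>. The Sylow subgroups of \<open>G\<close> for all other primes are contained in
  it, so its index is a power of \<open>p\<close>.\<close>

theorem frobenius_p_nilpotent:
  assumes "frobenius_condition"
  shows "p_nilpotent p G"
proof -
  define N where "N = {x. p_reg x}"
  have N: "subgroup N G"
  proof (rule subgroup_finiteI[OF finite_carrier])
    show "\<one> \<in> N" using p_regI[of \<one> 1] by (simp add: N_def)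
    show "x \<otimes> y \<in> N" if "x \<in> N" "y \<in> N" for x y
      using that frobenius_p_reg_mult[OF finite_group_prime_axioms assms] by (simp add: N_def)
  qed (auto simp: N_def p_reg_def)
  have "N \<lhd> G"
    using p_reg_cj by (intro normal_invI[OF N]) (auto simp: N_def cj_def)
  moreover have "coprime p (card N)"
  proof (rule prime_imp_coprime[OF prime_p], rule notI)
    assume dvd: "p dvd card N"
    obtain S where S: "sylow_in N S" using sylow_in_exists[OF N] .
    have "multiplicity p (card N) > 0"
      using dvd card_subgroup_pos[OF N] p_gt_1 by (simp add: multiplicity_gt_zero_iff)
    then have "card S > 1" using S one_less_power[OF p_gt_1] by (simp add: sylow_in_def)
    then have "\<not> S \<subseteq> {\<one>}" using card_mono[of "{\<one>}" S] by auto
    then obtain x where x: "x \<in> S" "x \<noteq> \<one>" by blast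
    have xN: "p_reg x" using x S by (auto simp: sylow_in_def N_def)
    obtain n where "x [^] (p ^ n) = \<one>" using p_subgroup_exponent[OF sylow_in_p_subgroup[OF S]] x(1) by blast
    then have "ord x dvd p ^ n" using xN by (simp add: pow_eq_id p_reg_def)
    moreover have "coprime (p ^ n) (ord x)" using xN by (simp add: p_reg_def)
    ultimately have "ord x = 1" using coprime_common_divisor[of "p ^ n" "ord x" "ord x"] by simp
    then show False using x xN ord_eq_1 by (simp add: p_reg_def)
  qed
  moreover have "\<exists>k. order (G Mod N) = p ^ k"
  proof -
    let ?n = "multiplicity p (order G)"
    have pos: "order G > 0" "card N > 0" using finite_carrier order_gt_0_iff_finite card_subgroup_pos[OF N] by auto
    have "order G dvd p ^ ?n * card N"
    proof (rule multiplicity_le_imp_dvd)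
      show "order G \<noteq> 0" using pos by simp
      fix q :: nat assume q: "Factorial_Ring.prime q"
      show "multiplicity q (order G) \<le> multiplicity q (p ^ ?n * card N)"
      proof (cases "q = p")
        case True
        have "p ^ ?n * card N \<noteq> 0" using pos p_gt_1 by simp
        then show ?thesis using True multiplicity_ge_nat[OF prime_p, of "p ^ ?n * card N" ?n] by simp
      next
        case False
        have "multiplicity q (order G) \<le> multiplicity q (card N)"
          using multiplicity_p_reg[OF subgroup_self N _ q False] by (simp add: N_def order_def)
        also have "\<dots> \<le> multiplicity q (p ^ ?n * card N)"
          using pos p_gt_1 by (intro dvd_imp_multiplicity_le) auto
        finally show ?thesis .
      qed
    qed
    then have "card (rcosets N) * card N dvd p ^ ?n * card N" by (simp only: lagrange[OF N])
    then have "card (rcosets N) dvd p ^ ?n" using pos by simp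
    then show ?thesis using divides_primepow_nat[OF prime_p] by (auto simp: order_def FactGroup_def)
  qed
  ultimately show ?thesis unfolding p_nilpotent_def by blast
qed

end

section \<open>Coprime action\<close>

text \<open>The units modulo \<open>p ^ k\<close> form a group of order
  \<open>p ^ (k - 1) * (p - 1)\<close>, which is coprime to \<open>m\<close>; a Bezout relation and
  Euler's theorem leave only \<open>a = 1\<close>.\<close>

lemma cong_one_if_power_cong_one:
  fixes a p :: nat
  assumes "Factorial_Ring.prime p" "[a ^ m = 1] (mod p ^ k)" "m > 0" "coprime p m" "coprime (p - 1) m"
  shows "[a = 1] (mod p ^ k)"
proof (cases "k = 0")
  case False
  have "[a * a ^ (m - 1) = 1] (mod p ^ k)"
    using assms(2,3) by (simp flip: power_Suc)
  then have "coprime a (p ^ k)" unfolding coprime_iff_invertible_nat by auto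
  then have t: "[a ^ totient (p ^ k) = 1] (mod p ^ k)" by (rule euler_theorem)
  let ?t = "totient (p ^ k)"
  have "coprime m ?t"
    using assms False by (simp add: totient_prime_power coprime_commute)
  then obtain i j where ij: "m * i = ?t * j + 1" using bezout_nat[of m ?t] assms(3) by auto
  have "[a ^ (m * i) = 1] (mod p ^ k)" using cong_pow[OF assms(2), of i] by (simp add: power_mult)
  moreover have "[a ^ (?t * j + 1) = 1 * a] (mod p ^ k)"
    using cong_mult[OF cong_pow[OF t, of j] cong_refl[of a]]
    by (simp only: power_add power_mult power_one_right power_one)
  ultimately show ?thesis unfolding ij by (simp add: cong_def)
qed simp

context group
begin

text \<open>The cyclic subgroup generated by \<open>y\<close>; natural exponents suffice in a finite
  group.\<close>

definition powers :: "'a \<Rightarrow> 'a set" where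
  "powers y = range (\<lambda>i::nat. y [^] i)"

lemma powers_subgroup:
  assumes "finite (carrier G)" "y \<in> carrier G"
  shows "subgroup (powers y) G"
proof (rule subgroup_finiteI[OF assms(1)])
  show "\<one> \<in> powers y" unfolding powers_def by (rule range_eqI[of _ _ 0]) simp
  fix a b assume "a \<in> powers y" "b \<in> powers y"
  then obtain i j :: nat where "a = y [^] i" "b = y [^] j" by (auto simp: powers_def)
  then have "a \<otimes> b = y [^] (i + j)" using assms(2) by (simp add: nat_pow_mult)
  then show "a \<otimes> b \<in> powers y" by (simp add: powers_def)
qed (use assms(2) in \<open>auto simp: powers_def\<close>)

lemma self_in_powers: "y \<in> carrier G \<Longrightarrow> y \<in> powers y"
  unfolding powers_def by (rule range_eqI[of _ _ 1]) simp

lemma powers_subset: "subgroup H G \<Longrightarrow> y \<in> H \<Longrightarrow> powers y \<subseteq> H"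
  by (auto simp: powers_def subgroup_nat_pow)

lemma card_powers_le:
  assumes "y \<in> carrier G" "y [^] (m::nat) = \<one>" "m > 0"
  shows "card (powers y) \<le> m"
proof -
  have "powers y \<subseteq> (\<lambda>i. y [^] i) ` {..<m}"
  proof
    fix a assume "a \<in> powers y"
    then obtain i :: nat where i: "a = y [^] i" by (auto simp: powers_def)
    have "y [^] i = y [^] (m * (i div m)) \<otimes> y [^] (i mod m)" using assms(1) by (simp add: nat_pow_mult)
    also have "y [^] (m * (i div m)) = \<one>"
      using assms(1,2) by (metis nat_pow_one nat_pow_pow)
    finally have "a = y [^] (i mod m)" using i assms(1) by simp
    moreover have "i mod m < m" using assms(3) by simp
    ultimately show "a \<in> (\<lambda>i. y [^] i) ` {..<m}" by blast
  qed
  then have "card (powers y) \<le> card {..<m}" using surj_card_le[of "{..<m}"] by blast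
  then show ?thesis by simp
qed

lemma norm_of_pow:
  assumes "K \<subseteq> carrier G" "x \<in> norm_of K"
  shows "x [^] (n::nat) \<in> norm_of K"
  using subgroup_nat_pow[OF norm_of_subgroup[OF assms(1)] assms(2)] .

lemma cj_cj:
  assumes "g \<in> carrier G" "h \<in> carrier G" "x \<in> carrier G"
  shows "cj g (cj h x) = cj (cj g h) (cj g x)"
  using assms by (simp add: cj_def m_assoc inv_mult_group)

lemma norm_of_cj:
  assumes "x \<in> norm_of K" "g \<in> carrier G" "K \<subseteq> carrier G"
  shows "cj g x \<in> norm_of (cj g ` K)"
proof -
  have x: "x \<in> carrier G" "cj x ` K = K" using assms(1) by (auto simp: norm_of_def)
  have "cj (cj g x) ` cj g ` K = cj g ` cj x ` K"
    unfolding image_image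
  proof (rule image_cong[OF refl])
    fix k assume "k \<in> K"
    then have "k \<in> carrier G" using assms(3) by blast
    from cj_cj[OF assms(2) x(1) this] show "cj (cj g x) (cj g k) = cj g (cj x k)" by simp
  qed
  then show ?thesis using x assms(2) by (simp add: norm_of_def)
qed

lemma cent_of_cj_iff:
  assumes "x \<in> carrier G" "g \<in> carrier G" "K \<subseteq> carrier G"
  shows "cj g x \<in> cent_of (cj g ` K) \<longleftrightarrow> x \<in> cent_of K"
proof -
  have "cj (cj g x) (cj g k) = cj g k \<longleftrightarrow> cj x k = k" if "k \<in> K" for k
  proof -
    have k: "k \<in> carrier G" using that assms(3) by blast
    have "cj g (cj x k) = cj g k \<longleftrightarrow> cj x k = k"
      using cj_inj_on[OF assms(2) subset_refl] k assms(1) by (simp add: inj_on_eq_iff)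
    then show ?thesis using cj_cj[OF assms(2,1) k] by simp
  qed
  then show ?thesis using assms by (simp add: cent_of_def)
qed

lemma pow_commute:
  assumes "x \<in> carrier G" "y \<in> carrier G" "x \<otimes> y = y \<otimes> x"
  shows "x [^] (n::nat) \<otimes> y = y \<otimes> x [^] n"
proof (induction n)
  case (Suc n)
  have "x [^] Suc n \<otimes> y = x [^] n \<otimes> y \<otimes> x" using assms by (simp add: m_assoc)
  also have "\<dots> = y \<otimes> x [^] Suc n" using assms(1,2) by (simp add: Suc m_assoc)
  finally show ?case .
qed (use assms in simp)

text \<open>\<open>c\<close> is the commutator of \<open>v\<close> and \<open>u\<close> and commutes
  with both. Moving \<open>u\<close> to the left past \<open>v [^] n\<close> costs
  \<open>c [^] n\<close>; collecting all factors costs the exponent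
  \<open>0 + 1 + ... + (n - 1)\<close>, which is \<open>n choose 2\<close>.\<close>

lemma class_two_pow:
  fixes n :: nat
  assumes u: "u \<in> carrier G" and v: "v \<in> carrier G" and c: "c \<in> carrier G"
    and comm: "v \<otimes> u = u \<otimes> v \<otimes> c" "c \<otimes> u = u \<otimes> c" "c \<otimes> v = v \<otimes> c"
  shows "v [^] n \<otimes> u = u \<otimes> v [^] n \<otimes> c [^] n"
    and "(u \<otimes> v) [^] n = u [^] n \<otimes> v [^] n \<otimes> c [^] (n choose 2)"
proof -
  have cv: "c [^] i \<otimes> v = v \<otimes> c [^] i" and cu: "c [^] i \<otimes> u = u \<otimes> c [^] i" for i :: nat
    using comm c u v by (simp_all only: pow_commute)
  show *: "v [^] n \<otimes> u = u \<otimes> v [^] n \<otimes> c [^] n" for n :: nat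
  proof (induction n)
    case (Suc n)
    have "v [^] Suc n \<otimes> u = v [^] n \<otimes> (v \<otimes> u)" using u v by (simp add: m_assoc)
    also have "\<dots> = (v [^] n \<otimes> u) \<otimes> (v \<otimes> c)" using u v c by (simp add: comm(1) m_assoc)
    also have "\<dots> = u \<otimes> v [^] n \<otimes> (c [^] n \<otimes> v) \<otimes> c" using u v c by (simp add: Suc m_assoc)
    also have "\<dots> = u \<otimes> v [^] Suc n \<otimes> c [^] Suc n" using u v c by (simp add: cv m_assoc)
    finally show ?case .
  qed (use u in simp)
  show "(u \<otimes> v) [^] n = u [^] n \<otimes> v [^] n \<otimes> c [^] (n choose 2)"
  proof (induction n)
    case (Suc n)
    let ?t = "n choose 2"
    have ch: "Suc n choose 2 = n + ?t" by (simp add: numeral_2_eq_2)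
    have "(u \<otimes> v) [^] Suc n = u [^] n \<otimes> v [^] n \<otimes> (c [^] ?t \<otimes> u) \<otimes> v" using u v c by (simp add: Suc m_assoc)
    also have "\<dots> = u [^] n \<otimes> (v [^] n \<otimes> u) \<otimes> (c [^] ?t \<otimes> v)" using u v c by (simp add: cu m_assoc)
    also have "\<dots> = u [^] n \<otimes> u \<otimes> v [^] n \<otimes> (c [^] n \<otimes> v) \<otimes> c [^] ?t"
      using u v c by (simp add: * m_assoc) (simp add: cv flip: m_assoc)
    also have "\<dots> = u [^] Suc n \<otimes> v [^] Suc n \<otimes> (c [^] n \<otimes> c [^] ?t)"
      using u v c by (simp add: cv m_assoc)
    finally show ?case using c by (simp only: ch nat_pow_mult)
  qed (use u in \<open>simp add: numeral_2_eq_2\<close>)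
qed

end

section \<open>Coprime action and the Frattini subgroup\<close>

context finite_group_prime
begin

text \<open>On a coset \<open>y \<langle>w\<rangle>\<close> the element \<open>x\<close> acts as translation by \<open>w\<close>,
  so the order of \<open>w\<close> divides that of \<open>x\<close>.\<close>

lemma coprime_translation_trivial:
  assumes "p_reg x" "y \<in> carrier G" "w \<in> carrier G" "cj x y = y \<otimes> w" "cj x w = w" "w [^] (p ^ n) = \<one>"
  shows "w = \<one>"
proof -
  have x: "x \<in> carrier G" "coprime p (ord x)" using assms(1) by (auto simp: p_reg_def)
  have w: "cj (x [^] m) w = w" for m :: nat
    by (induction m) (use x assms in \<open>simp_all add: cj_comp\<close>)
  have "cj (x [^] m) y = y \<otimes> w [^] m" for m :: nat
  proof (induction m)
    case (Suc m)
    have "cj (x [^] Suc m) y = cj (x [^] m) (y \<otimes> w)" using x assms by (simp add: cj_comp)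
    also have "\<dots> = y \<otimes> w [^] m \<otimes> w" using x assms Suc w by (simp add: cj_mult)
    finally show ?case using assms by (simp add: m_assoc)
  qed (use assms in simp)
  from this[of "ord x"] have "y \<otimes> w [^] ord x = y" using x assms(2) by simp
  then have "w [^] ord x = \<one>" using assms(2,3) by (metis l_cancel nat_pow_closed one_closed r_one)
  then have "ord w dvd ord x" "ord w dvd p ^ n" using assms(3,6) pow_eq_id by auto
  then have "ord w = 1"
    using x(2) coprime_common_divisor[of "p ^ n" "ord x" "ord w"] by simp
  then show ?thesis using ord_eq_1[OF assms(3)] by simp
qed

text \<open>The character with kernel \<open>M\<close> takes values in the \<open>p\<close>-th roots
  of unity, so it is trivial on \<open>p\<close>-th powers and commutators.\<close>

lemma index_p_contains:
  assumes "p_subgroup P" "subgroup M G" "M \<subseteq> P" "card P = p * card M"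
  shows "y \<in> P \<Longrightarrow> y [^] p \<in> M"
    and "\<lbrakk>y \<in> P; z \<in> P\<rbrakk> \<Longrightarrow> inv (y \<otimes> z) \<otimes> (z \<otimes> y) \<in> M"
proof -
  interpret P: subgroup P G using assms by (simp add: p_subgroup_def)
  obtain \<chi> :: "'a \<Rightarrow> complex" where
    chi: "\<And>x y. \<lbrakk>x \<in> P; y \<in> P\<rbrakk> \<Longrightarrow> \<chi> (x \<otimes> y) = \<chi> x * \<chi> y" "\<And>x. x \<in> P \<Longrightarrow> \<chi> x ^ p = 1"
      "\<And>x. x \<in> P \<Longrightarrow> \<chi> x = 1 \<longleftrightarrow> x \<in> M"
    by (rule index_p_character[OF assms]) (rule that)
  have one: "\<chi> \<one> = 1" using chi(3) subgroup.one_closed[OF assms(2)] by simp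
  have nz: "\<chi> s \<noteq> 0" if "s \<in> P" for s using chi(2)[OF that] p_gt_1 by (auto simp: power_0_left)
  have pw: "\<chi> (y [^] n) = \<chi> y ^ n" if "y \<in> P" for y and n :: nat
    by (induction n) (use that in \<open>simp_all add: one chi(1) subgroup_nat_pow[OF P.subgroup_axioms]\<close>)
  show "y [^] p \<in> M" if "y \<in> P"
    using chi(3)[OF subgroup_nat_pow[OF P.subgroup_axioms that]] pw[OF that] chi(2)[OF that] by simp
  show "inv (y \<otimes> z) \<otimes> (z \<otimes> y) \<in> M" if y: "y \<in> P" and z: "z \<in> P"
  proof -
    let ?c = "inv (y \<otimes> z) \<otimes> (z \<otimes> y)"
    have c: "?c \<in> P" using y z by simp
    have "\<chi> (y \<otimes> z) * \<chi> ?c = \<chi> (y \<otimes> z \<otimes> ?c)" using chi(1)[of "y \<otimes> z" ?c] y z c by simp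
    also have "y \<otimes> z \<otimes> ?c = z \<otimes> y" using y z P.mem_carrier by (simp add: inv_mult_group m_assoc)
    also have "\<chi> (z \<otimes> y) = \<chi> (y \<otimes> z)" using chi(1) y z by simp
    finally have "\<chi> ?c = 1" using nz[of "y \<otimes> z"] y z by simp
    then show ?thesis using chi(3)[OF c] by simp
  qed
qed

lemma index_p_exists:
  assumes "p_subgroup P" "P \<noteq> {\<one>}"
  obtains M where "subgroup M G" "M \<subseteq> P" "card P = p * card M"
proof -
  obtain n where P: "subgroup P G" "card P = p ^ n" using assms by (auto simp: p_subgroup_def)
  interpret P: subgroup P G by fact
  have "n \<noteq> 0"
  proof
    assume "n = 0"
    then obtain a where "P = {a}" using P(2) by (auto simp: card_1_singleton_iff)
    then show False using assms(2) P.one_closed by auto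
  qed
  then obtain l where l: "n = Suc l" using not0_implies_Suc by blast
  obtain M where "subgroup M G" "M \<subseteq> P" "card M = p ^ l"
    using p_subgroup_between[OF assms(1) triv_subgroup, of l] P l p_gt_1 by auto
  then show ?thesis using that P(2) l by simp
qed

text \<open>The maximal subgroups of a \<open>p\<close>-group are those of index \<open>p\<close>.
  With the index in the definition, \<open>index_p_contains\<close> yields \<open>p\<close>-th
  powers and commutators in it at once.\<close>

definition frattini :: "'a set \<Rightarrow> 'a set" where
  "frattini P = {y \<in> P. \<forall>M. subgroup M G \<and> M \<subseteq> P \<and> card P = p * card M \<longrightarrow> y \<in> M}"

lemma frattini_subgroup:
  assumes "p_subgroup P"
  shows "subgroup (frattini P) G"
proof (rule subgroup_finiteI[OF finite_carrier])
  have P: "subgroup P G" using assms by (simp add: p_subgroup_def)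
  show "frattini P \<subseteq> carrier G" using subgroup.subset[OF P] by (auto simp: frattini_def)
  show "\<one> \<in> frattini P" using subgroup.one_closed P by (auto simp: frattini_def)
  show "x \<otimes> y \<in> frattini P" if "x \<in> frattini P" "y \<in> frattini P" for x y
    unfolding frattini_def
  proof (intro CollectI conjI allI impI; (elim conjE)?)
    show "x \<otimes> y \<in> P" using that subgroup.m_closed[OF P] by (simp add: frattini_def)
    fix M assume M: "subgroup M G" "M \<subseteq> P" "card P = p * card M"
    then have "x \<in> M" "y \<in> M" using that unfolding frattini_def by blast+
    then show "x \<otimes> y \<in> M" using subgroup.m_closed[OF M(1)] by blast
  qed
qed

lemma frattini_psubset:
  assumes "p_subgroup P" "P \<noteq> {\<one>}"
  shows "frattini P \<subset> P"
proof -
  obtain M where M: "subgroup M G" "M \<subseteq> P" "card P = p * card M" using index_p_exists[OF assms] .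
  then have "frattini P \<subseteq> M" by (auto simp: frattini_def)
  moreover have "M \<noteq> P" using M(3) card_subgroup_pos[OF M(1)] p_gt_1 by auto
  ultimately show ?thesis using M(2) by blast
qed

lemma frattini_cj:
  assumes "p_subgroup P" "g \<in> norm_of P" "y \<in> frattini P"
  shows "cj g y \<in> frattini P"
proof -
  have P: "subgroup P G" "P \<subseteq> carrier G" using assms(1) subgroup.subset by (auto simp: p_subgroup_def)
  have g: "g \<in> carrier G" "cj g ` P = P" using assms(2) by (auto simp: norm_of_def)
  have y: "y \<in> P" "y \<in> carrier G" using assms(3) P by (auto simp: frattini_def)
  have "cj g y \<in> M" if M: "subgroup M G" "M \<subseteq> P" "card P = p * card M" for M
  proof -
    have "cj (inv g) ` P = P" using cj_image_cancel(2)[OF g(1) P(2)] g(2) by simp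
    then have sub: "cj (inv g) ` M \<subseteq> P" using M(2) by blast
    have "card (cj (inv g) ` M) = card M" using cj_image_card g(1) M(2) P(2) by auto
    then have "y \<in> cj (inv g) ` M"
      using assms(3) subgroup_cj[OF M(1), of "inv g"] sub M(3) g(1) by (simp add: frattini_def)
    then obtain m where m: "m \<in> M" "y = cj (inv g) m" by blast
    then have "cj g y = m" using g(1) M(2) P(2) by auto
    then show ?thesis using m by simp
  qed
  then show ?thesis using y g(2) by (auto simp: frattini_def)
qed

text \<open>With \<open>w y = y\<^sup>-\<^sup>1 (x y x\<^sup>-\<^sup>1)\<close>, either the \<open>w y\<close> generate a proper subgroup, which is
  centralized by induction, or they generate \<open>K\<close>. In the latter case the Frattini subgroup is
  centralized by \<open>x\<close>, hence by every \<open>w y\<close>, hence central in \<open>K\<close>. Then \<open>K\<close> has class at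
  most two and the power formula shows that \<open>w y\<close> has order dividing \<open>p\<close>, or \<open>4\<close>.\<close>

lemma centralizes_if_small_orders:
  assumes "p_subgroup K" "p_reg x" "x \<in> norm_of K"
    and "\<And>y. \<lbrakk>y \<in> K; y [^] p = \<one>\<rbrakk> \<Longrightarrow> cj x y = y"
    and "p = 2 \<Longrightarrow> (\<forall>a\<in>K. \<forall>b\<in>K. a \<otimes> b = b \<otimes> a) \<or> (\<forall>y\<in>K. y [^] (4::nat) = \<one> \<longrightarrow> cj x y = y)"
  shows "x \<in> cent_of K"
  using assms(1,3-)
proof (induction "card K" arbitrary: K rule: less_induct)
  case less
  have x: "x \<in> carrier G" using assms(2) by (simp add: p_reg_def)
  interpret K: subgroup K G using less.prems by (simp add: p_subgroup_def)
  have xK: "cj x y \<in> K" if "y \<in> K" for y using less.prems(2) that by (auto simp: norm_of_def)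
  obtain n where pn: "\<And>y. y \<in> K \<Longrightarrow> y [^] (p ^ n) = \<one>" using p_subgroup_exponent[OF less.prems(1)] by blast
  have IH: "x \<in> cent_of L" if L: "subgroup L G" "L \<subset> K" and xL: "\<And>y. y \<in> L \<Longrightarrow> cj x y \<in> L" for L
  proof (rule less.hyps)
    show "card L < card K" using L(2) finite_subgroup[OF K.subgroup_axioms] psubset_card_mono by blast
    show "p_subgroup L" using p_subgroup_subset[OF less.prems(1) L(1)] L(2) by blast
    show "x \<in> norm_of L"
      using norm_of_iff_subset[OF finite_subgroup[OF L(1)] subgroup.subset[OF L(1)]] x xL by blast
    show "cj x y = y" if "y \<in> L" "y [^] p = \<one>" for y using less.prems(3) that L(2) by blast
    show "(\<forall>a\<in>L. \<forall>b\<in>L. a \<otimes> b = b \<otimes> a) \<or> (\<forall>y\<in>L. y [^] (4::nat) = \<one> \<longrightarrow> cj x y = y)" if "p = 2"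
      using less.prems(4)[OF that] L(2) by blast
  qed
  define w where "w y = inv y \<otimes> cj x y" for y
  have wK: "w y \<in> K" if "y \<in> K" for y using that xK by (simp add: w_def)
  have cjw: "cj x y = y \<otimes> w y" if "y \<in> K" for y using that xK x by (simp add: w_def)
  have fixed: "cj x y = y" if y: "y \<in> K" and "cj x (w y) = w y" for y
  proof -
    have "w y = \<one>"
      using coprime_translation_trivial[OF assms(2) _ _ cjw[OF y] that(2) pn[OF wK[OF y]]] y wK[OF y] by simp
    then show ?thesis using cjw[OF y] y by simp
  qed
  define W where "W = generate G (w ` K)"
  have wG: "w ` K \<subseteq> carrier G" using wK K.subset by blast
  have W: "subgroup W G" unfolding W_def by (rule generate_is_subgroup[OF wG])
  have wW: "w y \<in> W" if "y \<in> K" for y unfolding W_def using that by (simp add: generate.incl)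
  have WK: "W \<subseteq> K" unfolding W_def by (rule generate_subgroup_incl[OF _ K.subgroup_axioms]) (use wK in blast)
  show ?case
  proof (cases "W = K")
    case False
    \<comment> \<open>\<open>w\<close> commutes with conjugation by \<open>x\<close>, so
      \<open>W\<close> is invariant under \<open>x\<close>.\<close>
    have "W \<subseteq> {v \<in> W. cj x v \<in> W}" unfolding W_def
    proof (rule generate_subgroup_incl, fold W_def)
      show "w ` K \<subseteq> {v \<in> W. cj x v \<in> W}"
      proof clarify
        fix y assume y: "y \<in> K"
        have "cj x (w y) = w (cj x y)" using y x xK by (simp add: w_def cj_mult cj_inv)
        then show "w y \<in> W \<and> cj x (w y) \<in> W" using wW y xK by simp
      qed
      show "subgroup {v \<in> W. cj x v \<in> W} G"
        by (rule subgroup_finiteI[OF finite_carrier])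
          (use W x subgroup.mem_carrier[OF W] in \<open>auto simp: cj_mult subgroup.m_closed subgroup.one_closed\<close>)
    qed
    then have "x \<in> cent_of W" using IH[OF W] WK False by blast
    then have "cj x y = y" if "y \<in> K" for y using fixed[OF that] wW[OF that] by (auto simp: cent_of_def)
    then show ?thesis using x by (simp add: cent_of_def)
  next
    case WK_eq: True
    show ?thesis
    proof (cases "K = {\<one>}")
      case True
      then show ?thesis using x by (simp add: cent_of_def)
    next
      case False
      let ?F = "frattini K"
      have FK: "?F \<subset> K" using frattini_psubset[OF less.prems(1) False] .
      have F: "subgroup ?F G" using frattini_subgroup[OF less.prems(1)] .
      have xF: "x \<in> cent_of ?F" using IH[OF F FK] frattini_cj[OF less.prems(1,2)] by blast
      have central: "f \<otimes> k = k \<otimes> f" if f: "f \<in> ?F" and k: "k \<in> K" for f k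
      proof -
        have fG: "f \<in> carrier G" using f F subgroup.mem_carrier by metis
        \<comment> \<open>\<open>x\<close> fixes both \<open>f\<close> and \<open>cj y f\<close>, so
          \<open>y\<close> and \<open>cj x y\<close> conjugate \<open>f\<close> to the same element;
          hence \<open>w y\<close> centralizes \<open>f\<close>.\<close>
        have "w ` K \<subseteq> cent_of {f}"
        proof clarify
          fix y assume y: "y \<in> K"
          then have yG: "y \<in> carrier G" "cj x y \<in> carrier G" using x by auto
          have "y \<in> norm_of K" using y subgroup_subset_norm_of[OF K.subgroup_axioms] by blast
          then have "cj y f \<in> ?F" using frattini_cj[OF less.prems(1) _ f] by blast
          then have "cj y f = cj x (cj y f)" using xF by (simp add: cent_of_def)
          also have "\<dots> = cj (cj x y) (cj x f)" using cj_cj[OF x yG(1) fG] .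
          also have "cj x f = f" using xF f by (simp add: cent_of_def)
          finally have "cj (inv y) (cj y f) = cj (inv y) (cj (cj x y) f)" by simp
          then have "cj (w y) f = f" using yG fG by (simp add: w_def cj_comp)
          then show "w y \<in> cent_of {f}" using yG by (simp add: cent_of_def w_def)
        qed
        moreover have "subgroup (cent_of {f}) G" using cent_of_subgroup[of "{f}"] fG by simp
        ultimately have "W \<subseteq> cent_of {f}" unfolding W_def by (rule generate_subgroup_incl)
        then have "K \<subseteq> cent_of {f}" using WK_eq by simp
        then have "cj k f = f" using k by (auto simp: cent_of_def)
        then show ?thesis using cj_fixed_iff[of k f] fG k by simp
      qed
      have "cj x y = y" if y: "y \<in> K" for y
      proof (rule fixed[OF y])
        \<comment> \<open>\<open>w y\<close> is the product of \<open>u\<close> and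
          \<open>v\<close>, to which the class two formula applies. As \<open>x\<close> fixes
          \<open>y [^] p\<close>, the \<open>p\<close>-th powers of \<open>u\<close> and
          \<open>v\<close> cancel.\<close>
        define u v where "u = inv y" and "v = cj x y"
        have uK: "u \<in> K" and vK: "v \<in> K" using y xK by (auto simp: u_def v_def)
        have uG: "u \<in> carrier G" and vG: "v \<in> carrier G" using uK vK by auto
        define c where "c = inv (u \<otimes> v) \<otimes> (v \<otimes> u)"
        have cF: "c \<in> ?F"
          using index_p_contains(2)[OF less.prems(1) _ _ _ uK vK] uK vK by (auto simp: frattini_def c_def)
        have ypF: "y [^] p \<in> ?F"
          using index_p_contains(1)[OF less.prems(1) _ _ _ y] subgroup_nat_pow[OF K.subgroup_axioms y]
          by (auto simp: frattini_def)
        have cG: "c \<in> carrier G" using uG vG by (simp add: c_def)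
        have comm: "v \<otimes> u = u \<otimes> v \<otimes> c" "c \<otimes> u = u \<otimes> c" "c \<otimes> v = v \<otimes> c"
          using uG vG central[OF cF] uK vK by (auto simp: c_def m_assoc inv_mult_group)
        have vp: "v [^] p = y [^] p"
          using xF ypF x y by (simp add: v_def cj_pow[symmetric] cent_of_def)
        have "v [^] p \<otimes> u = u \<otimes> v [^] p" using central[OF ypF uK] vp by simp
        then have "u \<otimes> v [^] p \<otimes> c [^] p = u \<otimes> v [^] p"
          using class_two_pow(1)[OF uG vG cG comm, of p] by simp
        then have cp: "c [^] p = \<one>" using uG vG cG by (metis m_closed nat_pow_closed one_closed l_cancel r_one)
        have "w y [^] p = u [^] p \<otimes> v [^] p \<otimes> c [^] (p choose 2)"
          using class_two_pow(2)[OF uG vG cG comm, of p] by (simp add: w_def u_def v_def)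
        also have "u [^] p \<otimes> v [^] p = \<one>" using y by (simp add: u_def vp nat_pow_inv)
        finally have wp: "w y [^] p = c [^] (p choose 2)" using cG by simp
        show "cj x (w y) = w y"
        proof (cases "p = 2")
          case False
          have "even (p * (p - 1))" using p_gt_1 by (cases "even p") auto
          then have "2 * (p choose 2) = p * (p - 1)" unfolding choose_two by (rule dvd_mult_div_cancel)
          then have "p dvd 2 * (p choose 2)" by simp
          then have "p dvd (p choose 2)"
            using prime_p False by (metis prime_dvd_mult_iff primes_dvd_imp_eq two_is_prime_nat)
          then obtain t where "p choose 2 = p * t" by blast
          then have "w y [^] p = \<one>" using wp cp cG by (simp flip: nat_pow_pow)
          then show ?thesis using less.prems(3) wK[OF y] by blast
        next
          case True
          show ?thesis
          proof (cases "\<forall>a\<in>K. \<forall>b\<in>K. a \<otimes> b = b \<otimes> a")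
            case ab: True
            have "c = \<one>" using ab uK vK uG vG by (simp add: c_def)
            then have "w y [^] p = \<one>" using wp by simp
            then show ?thesis using less.prems(3) wK[OF y] by blast
          next
            case nab: False
            \<comment> \<open>For \<open>p = 2\<close> the exponent \<open>p choose 2\<close> is 1,
              so \<open>c\<close> survives and only the fourth power is sure to vanish.\<close>
            have "w y [^] (2::nat) = c" using wp True cG by (simp add: numeral_2_eq_2)
            then have "(w y [^] (2::nat)) [^] (2::nat) = \<one>" using cp True by simp
            then have "w y [^] (4::nat) = \<one>" using wK[OF y] by (simp add: nat_pow_pow)
            then show ?thesis using less.prems(4)[OF True] nab wK[OF y] by blast
          qed
        qed
      qed
      then show ?thesis using x by (simp add: cent_of_def)
    qed
  qed
qed

end

section \<open>Consequences of \<open>p - 1\<close> being coprime to the group order\<close>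

context finite_group_prime
begin

lemma p_reg_coprime_pred:
  assumes "coprime (p - 1) (order G)" "p_reg x"
  shows "ord x > 0" "coprime p (ord x)" "coprime (p - 1) (ord x)"
proof -
  have x: "x \<in> carrier G" using assms(2) by (simp add: p_reg_def)
  have "ord x dvd order G" using ord_dvd_group_order[OF x] .
  then show "coprime (p - 1) (ord x)" using assms(1) coprime_divisors dvd_refl by blast
  show "coprime p (ord x)" using assms(2) by (simp add: p_reg_def)
  show "ord x > 0" using ord_ge_1[OF finite_carrier x] by simp
qed

text \<open>\<open>x\<close> acts on the cyclic group by an exponent \<open>a\<close> with
  \<open>a ^ ord x\<close> congruent to 1 modulo \<open>ord y\<close>, and \<open>ord x\<close> is
  coprime to \<open>p\<close> and to \<open>p - 1\<close>; so \<open>a\<close> itself is congruent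
  to 1.\<close>

lemma p_reg_centralizes_cyclic:
  assumes "coprime (p - 1) (order G)" "p_reg x" "y \<in> carrier G" "y [^] (p ^ n) = \<one>"
    and "cj x y \<in> powers y"
  shows "cj x y = y"
proof -
  have x: "x \<in> carrier G" using assms(2) by (simp add: p_reg_def)
  obtain a :: nat where a: "cj x y = y [^] a" using assms(5) by (auto simp: powers_def)
  have "ord y dvd p ^ n" using assms(3,4) pow_eq_id by blast
  then obtain k where k: "ord y = p ^ k" using divides_primepow_nat[OF prime_p] by blast
  have red: "y [^] i = y [^] j \<longleftrightarrow> [i = j] (mod p ^ k)" for i j :: nat
  proof -
    have "y [^] i = y [^] j \<longleftrightarrow> y [^] int i = y [^] int j" by (simp add: int_pow_int)
    also have "\<dots> \<longleftrightarrow> int (ord y) dvd int j - int i" using int_pow_eq[OF assms(3)] by simp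
    also have "\<dots> \<longleftrightarrow> [int j = int i] (mod int (p ^ k))" unfolding k by (simp add: cong_iff_dvd_diff)
    also have "\<dots> \<longleftrightarrow> [i = j] (mod p ^ k)" by (metis cong_int_iff cong_sym_eq)
    finally show ?thesis .
  qed
  have "cj (x [^] m) y = y [^] (a ^ m)" for m :: nat
  proof (induction m)
    case (Suc m)
    have "cj (x [^] Suc m) y = cj (x [^] m) (y [^] a)" using x assms(3) a by (simp add: cj_comp)
    also have "\<dots> = (y [^] (a ^ m)) [^] a" using x assms(3) Suc by (simp add: cj_pow)
    finally show ?case using assms(3) by (simp add: nat_pow_pow mult.commute)
  qed (use assms(3) in simp)
  from this[of "ord x"] have "y [^] (a ^ ord x) = y [^] (1::nat)" using x assms(3) by simp
  then have "[a ^ ord x = 1] (mod p ^ k)" using red by blast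
  then have "[a = 1] (mod p ^ k)"
    using cong_one_if_power_cong_one[OF prime_p] p_reg_coprime_pred[OF assms(1,2)] by blast
  then have "y [^] a = y [^] (1::nat)" using red by blast
  then show ?thesis using a assms(3) by simp
qed

text \<open>The quotient of \<open>L\<close> by \<open>M\<close>, represented by the values of
  \<open>\<chi>\<close>, is cyclic of order \<open>p\<close>. So \<open>x\<close> acts on it by an
  exponent \<open>a\<close> whose \<open>ord x\<close>-th power is 1 modulo \<open>p\<close>, and
  coprimality with \<open>p - 1\<close> forces \<open>a\<close> to be 1 modulo
  \<open>p\<close>.\<close>

lemma p_reg_trivial_on_index_p:
  assumes "coprime (p - 1) (order G)" "p_reg x"
    and L: "p_subgroup L" "subgroup M G" "M \<subseteq> L" "card L = p * card M"
    and x: "x \<in> norm_of L" "x \<in> norm_of M" and y: "y \<in> L"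
  shows "inv y \<otimes> cj x y \<in> M"
proof -
  interpret L: subgroup L G using L by (simp add: p_subgroup_def)
  interpret M: subgroup M G using L by simp
  have xG: "x \<in> carrier G" using x by (simp add: norm_of_def)
  have xL: "cj (x [^] m) y \<in> L" if "y \<in> L" for y and m :: nat
    using norm_of_pow[OF L.subset x(1), of m] that by (auto simp: norm_of_def)
  have xM: "cj (x [^] m) y \<in> M" if "y \<in> M" for y and m :: nat
    using norm_of_pow[OF M.subset x(2), of m] that by (auto simp: norm_of_def)
  obtain \<chi> :: "'a \<Rightarrow> complex" and z where
    chi: "\<And>x y. \<lbrakk>x \<in> L; y \<in> L\<rbrakk> \<Longrightarrow> \<chi> (x \<otimes> y) = \<chi> x * \<chi> y" "\<And>x. x \<in> L \<Longrightarrow> \<chi> x ^ p = 1"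
      "\<And>x. x \<in> L \<Longrightarrow> \<chi> x = 1 \<longleftrightarrow> x \<in> M"
    and z: "z \<in> L" "z \<notin> M" "\<And>x. x \<in> L \<Longrightarrow> \<exists>i. \<chi> x = \<chi> z ^ i"
    by (rule index_p_character[OF L]) (rule that)
  have one: "\<chi> \<one> = 1" using chi(3) by simp
  have nz: "\<chi> s \<noteq> 0" if "s \<in> L" for s using chi(2)[OF that] p_gt_1 by (auto simp: power_0_left)
  have inv: "\<chi> (inv s) * \<chi> s = 1" if "s \<in> L" for s using chi(1)[of "inv s" s] that one by simp
  have pw: "\<chi> (y [^] n) = \<chi> y ^ n" if "y \<in> L" for y and n :: nat
    by (induction n) (use that in \<open>simp_all add: one chi(1) subgroup_nat_pow[OF L.subgroup_axioms]\<close>)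
  \<comment> \<open>As \<open>x\<close> preserves the kernel \<open>M\<close>, its effect on values
    of \<open>\<chi>\<close> is determined by what it does to \<open>z\<close>.\<close>
  have transport: "\<chi> (cj (x [^] m) y) = \<chi> (cj (x [^] m) z) ^ i"
    if y: "y \<in> L" and eq: "\<chi> y = \<chi> z ^ i" for y i and m :: nat
  proof -
    let ?k = "y \<otimes> inv (z [^] i)"
    have zi: "z [^] i \<in> L" using subgroup_nat_pow[OF L.subgroup_axioms z(1)] .
    have "\<chi> ?k = 1" using chi(1)[of y "inv (z [^] i)"] y zi inv[OF zi] eq pw[OF z(1)] by (simp add: mult.commute)
    then have k: "?k \<in> M" using chi(3) y zi by simp
    have "cj (x [^] m) y = cj (x [^] m) (?k \<otimes> z [^] i)" using y zi by (simp add: m_assoc)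
    also have "\<dots> = cj (x [^] m) ?k \<otimes> cj (x [^] m) z [^] i"
      using y zi z(1) xG by (simp add: cj_mult cj_pow)
    finally have "\<chi> (cj (x [^] m) y) = \<chi> (cj (x [^] m) ?k) * \<chi> (cj (x [^] m) z [^] i)"
      using chi(1)[OF subsetD[OF L(3) xM[OF k]] subgroup_nat_pow[OF L.subgroup_axioms xL[OF z(1)]]] by simp
    also have "\<chi> (cj (x [^] m) ?k) = 1" using xM[OF k] chi(3) L(3) by blast
    finally show ?thesis using pw[OF xL[OF z(1)]] by simp
  qed
  have xz: "cj x z \<in> L" using xL[OF z(1), of 1] xG by simp
  then obtain a where a: "\<chi> (cj x z) = \<chi> z ^ a" using z(3) by blast
  have "\<chi> (cj (x [^] m) z) = \<chi> z ^ (a ^ m)" for m :: nat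
  proof (induction m)
    case (Suc m)
    have "cj (x [^] Suc m) z = cj (x [^] m) (cj x z)" using xG z(1) by (simp add: cj_comp)
    then have "\<chi> (cj (x [^] Suc m) z) = (\<chi> z ^ (a ^ m)) ^ a" using transport[OF xz a, of m] Suc by simp
    then show ?case by (simp flip: power_mult add: mult.commute)
  qed (use z in simp)
  from this[of "ord x"] have zz: "\<chi> z ^ (a ^ ord x) = \<chi> z" using xG z(1) by simp
  have z1: "\<chi> z \<noteq> 1" using chi(3) z by blast
  have p_dvd: "p dvd i" if "\<chi> z ^ i = 1" for i
  proof (rule ccontr)
    assume "\<not> p dvd i"
    then have "coprime p i" using prime_p prime_imp_coprime by blast
    then show False using roots_of_unity_coprime[OF that chi(2)[OF z(1)]] z1 by blast
  qed
  have cong: "[i = 1] (mod p)" if "\<chi> z ^ i = \<chi> z" for i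
  proof (cases i)
    case 0
    then show ?thesis using that z1 by simp
  next
    case (Suc j)
    then have "\<chi> z ^ j = 1" using that nz[OF z(1)] by simp
    then show ?thesis using p_dvd[of j] Suc by (simp add: cong_altdef_nat' cong_def mod_Suc)
  qed
  have "[a ^ ord x = 1] (mod p ^ 1)" using cong[OF zz] by simp
  then have "[a = 1] (mod p ^ 1)"
    using cong_one_if_power_cong_one[OF prime_p] p_reg_coprime_pred[OF assms(1,2)] by blast
  have fix_z: "\<chi> (cj x z) = \<chi> z"
  proof -
    have "\<chi> z ^ a = \<chi> z ^ (p * (a div p)) * \<chi> z ^ (a mod p)" by (simp flip: power_add)
    also have "\<dots> = \<chi> z ^ (a mod p)" using chi(2)[OF z(1)] by (simp add: power_mult)
    also have "a mod p = 1" using \<open>[a = 1] (mod p ^ 1)\<close> p_gt_1 by (simp add: cong_def)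
    finally show ?thesis using a by simp
  qed
  obtain i where i: "\<chi> y = \<chi> z ^ i" using z(3)[OF y] by blast
  have xy: "cj x y \<in> L" using xL[OF y, of 1] xG by simp
  have "\<chi> (cj x y) = \<chi> y" using transport[OF y i, of 1] xG fix_z i by simp
  then have "\<chi> (inv y \<otimes> cj x y) = 1" using chi(1)[of "inv y" "cj x y"] xy y inv[OF y] by simp
  then show ?thesis using chi(3) xy y by simp
qed

lemma p_part_power:
  assumes "n \<in> carrier G"
  obtains a where "p_reg (n [^] (p ^ a))"
proof -
  have "ord n \<noteq> 0" using ord_ge_1[OF finite_carrier assms] by simp
  then obtain r where r: "ord n = p ^ multiplicity p (ord n) * r" "\<not> p dvd r"
    using multiplicity_decompose'[of "ord n" p] p_gt_1 by (metis less_irrefl nat_dvd_1_iff_1)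
  have "(n [^] (p ^ multiplicity p (ord n))) [^] r = \<one>"
    using assms r(1) pow_ord_eq_1[OF assms] by (simp add: nat_pow_pow)
  moreover have "coprime p r" using r(2) prime_p prime_imp_coprime by blast
  ultimately show ?thesis using that p_regI assms by blast
qed

text \<open>Otherwise a subgroup maximal subject to containing the \<open>p\<close>-th powers and avoiding
  \<open>w\<close> has index \<open>p\<close>.\<close>

lemma abelian_p_power_if_in_index_p:
  assumes L: "p_subgroup L" and ab: "\<And>a b. \<lbrakk>a \<in> L; b \<in> L\<rbrakk> \<Longrightarrow> a \<otimes> b = b \<otimes> a" and w: "w \<in> L"
    and all: "\<And>M. \<lbrakk>subgroup M G; M \<subseteq> L; card L = p * card M\<rbrakk> \<Longrightarrow> w \<in> M"
  obtains v where "v \<in> L" "w = v [^] p"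
proof (rule ccontr)
  assume nt: "\<not> thesis"
  interpret L: subgroup L G using L by (simp add: p_subgroup_def)
  \<comment> \<open>Containing \<open>Q\<close> ensures that adjoining any \<open>z\<close> to
    \<open>M\<close> multiplies its order by at most \<open>p\<close>.\<close>
  define Q where "Q = (\<lambda>v. v [^] p) ` L"
  have wQ: "w \<notin> Q" using nt that by (auto simp: Q_def)
  have "subgroup Q G"
  proof (rule subgroup_finiteI[OF finite_carrier])
    show "Q \<subseteq> carrier G" by (auto simp: Q_def)
    have "\<one> = \<one> [^] p" by simp
    then show "\<one> \<in> Q" unfolding Q_def using L.one_closed by blast
    fix x y assume "x \<in> Q" "y \<in> Q"
    then obtain a b where a: "a \<in> L" "x = a [^] p" and b: "b \<in> L" "y = b [^] p" by (auto simp: Q_def)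
    then have "x \<otimes> y = (a \<otimes> b) [^] p" using ab[OF a(1) b(1)] pow_mult_distrib by simp
    then show "x \<otimes> y \<in> Q" using a b by (auto simp: Q_def)
  qed
  moreover have "Q \<subseteq> L" using subgroup_nat_pow[OF L.subgroup_axioms] by (auto simp: Q_def)
  ultimately have ex: "\<exists>M. subgroup M G \<and> Q \<subseteq> M \<and> M \<subseteq> L \<and> w \<notin> M" using wQ by blast
  have bound: "\<forall>M. subgroup M G \<and> Q \<subseteq> M \<and> M \<subseteq> L \<and> w \<notin> M \<longrightarrow> card M < Suc (card L)"
    using card_mono[OF finite_subgroup[OF L.subgroup_axioms]] by (auto simp: less_Suc_eq_le)
  obtain M where "subgroup M G \<and> Q \<subseteq> M \<and> M \<subseteq> L \<and> w \<notin> M"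
    and max: "\<forall>M'. subgroup M' G \<and> Q \<subseteq> M' \<and> M' \<subseteq> L \<and> w \<notin> M' \<longrightarrow> card M' \<le> card M"
    using ex_has_greatest_nat[OF _ bound] ex by (elim exE) metis
  then have M: "subgroup M G" "Q \<subseteq> M" "M \<subseteq> L" "w \<notin> M" by blast+
  have cM: "card M > 0" using card_subgroup_pos[OF M(1)] .
  have larger: "w \<in> M'" if "subgroup M' G" "M \<subset> M'" "M' \<subseteq> L" for M'
  proof (rule ccontr)
    assume "w \<notin> M'"
    then have "card M' \<le> card M" using max that M(2) by blast
    moreover have "card M < card M'" using psubset_card_mono[OF finite_subgroup[OF that(1)] that(2)] .
    ultimately show False by simp
  qed
  obtain N where N: "subgroup N G" "M \<subseteq> N" "N \<subseteq> L" "card N = p * card M"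
    using p_subgroup_cover[OF L M(1)] M(3,4) w by blast
  \<comment> \<open>A \<open>z\<close> outside \<open>N\<close> would give a second extension
    \<open>M2\<close> of \<open>M\<close>. By maximality of \<open>M\<close> both contain
    \<open>w\<close>, so \<open>M2 \<inter> N\<close> is larger than \<open>M\<close> and fills
    \<open>M2\<close>, although \<open>z\<close> is not in \<open>N\<close>.\<close>
  have "N = L"
  proof (rule ccontr)
    assume "N \<noteq> L"
    then obtain z where z: "z \<in> L" "z \<notin> N" using N(3) by blast
    have zG: "z \<in> carrier G" using z by simp
    define M2 where "M2 = {k \<otimes> z [^] i |k i::nat. k \<in> M}"
    have "cj z k = k" if "k \<in> M" for k
      using cj_fixed_iff[OF zG] ab[OF z(1)] that M(3) by auto
    then have zM: "z \<in> norm_of M" using zG by (auto simp: norm_of_def image_def)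
    have zp: "z [^] p \<in> M" using z(1) M(2) by (auto simp: Q_def)
    have M2: "subgroup M2 G" "card M2 \<le> p * card M"
      unfolding M2_def using cyclic_extension[OF M(1) zM zp] by auto
    have MsM2: "M \<subseteq> M2" "z \<in> M2" unfolding M2_def using cyclic_extension_superset[OF M(1) zG] by auto
    have M2L: "M2 \<subseteq> L"
      unfolding M2_def using M(3) subgroup_nat_pow[OF L.subgroup_axioms z(1)] by auto
    have zM': "z \<notin> M" using z(2) N(2) by blast
    have "M \<noteq> N" using N(4) cM p_gt_1 by auto
    have "w \<in> M2 \<inter> N"
      using larger[OF M2(1) _ M2L] larger[OF N(1) _ N(3)] MsM2 zM' N(2) \<open>M \<noteq> N\<close> by blast
    then have sub: "M \<subset> M2 \<inter> N" using M(4) MsM2(1) N(2) by blast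
    have I: "subgroup (M2 \<inter> N) G" using subgroups_Inter_pair[OF M2(1) N(1)] .
    have Ip: "p_subgroup (M2 \<inter> N)" using p_subgroup_subset[OF L I] M2L by blast
    have "p * card M dvd card (M2 \<inter> N)" using p_subgroup_card_psubset[OF Ip M(1) sub] .
    then have "card M2 \<le> card (M2 \<inter> N)"
      using M2(2) dvd_imp_le[OF _ card_subgroup_pos[OF I]] le_trans by blast
    then have "M2 \<inter> N = M2" using card_seteq[OF finite_subgroup[OF M2(1)]] by blast
    then show False using MsM2(2) z(2) by blast
  qed
  then show False using all[OF M(1,3)] N(4) M(4) by blast
qed

end

section \<open>The subnormalizer condition\<close>

text \<open>The hypotheses of the theorem with \<open>|D| = p ^ e\<close>, in terms of
  \<open>norm_of\<close> and elements. Cyclic subgroups of order 4 appear as \<open>powers y\<close>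
  because they are met through a generator.\<close>

locale subnormalizer_setting = finite_group_prime +
  fixes S :: "'a set" and e :: nat
  assumes S: "sylow_in (carrier G) S"
    and coprime_pred: "coprime (p - 1) (order G)"
    and e_pos: "0 < e" and card_S: "p ^ e < card S"
    and norm_mono: "\<And>H K. \<lbrakk>subgroup H G; H \<subseteq> K; subgroup K G; K \<subseteq> S; card H = p ^ e\<rbrakk>
        \<Longrightarrow> norm_of K \<subseteq> norm_of H"
    and abelian: "\<And>L a b. \<lbrakk>subgroup L G; L \<subseteq> S; card L = p * p ^ e; a \<in> L; b \<in> L\<rbrakk> \<Longrightarrow> a \<otimes> b = b \<otimes> a"
    and norm_mono_four: "\<And>y K. \<lbrakk>p = 2; e = 1; \<not> (\<forall>a\<in>S. \<forall>b\<in>S. a \<otimes> b = b \<otimes> a);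
        y \<in> K; subgroup K G; K \<subseteq> S; card (powers y) = 4\<rbrakk> \<Longrightarrow> norm_of K \<subseteq> norm_of (powers y)"
begin

lemma S_p_subgroup: "p_subgroup S"
  using S by (rule sylow_in_p_subgroup)

text \<open>\<open>H\<close> is proper in \<open>K\<close>, so an abelian \<open>L\<close> of order
  \<open>p * p ^ e\<close> fits between them. The cases are whether \<open>L\<close> has a second
  subgroup of order \<open>p ^ e\<close>; an abelian \<open>p\<close>-group with a unique subgroup
  of index \<open>p\<close> is cyclic.\<close>

lemma centralizes_subgroup_of_card_pe:
  assumes K: "subgroup K G" "K \<subseteq> S" and x: "p_reg x" "x \<in> norm_of K"
    and H: "subgroup H G" "H \<subset> K" "card H = p ^ e"
  shows "x \<in> cent_of H"
proof -
  have Kp: "p_subgroup K" using p_subgroup_subset[OF S_p_subgroup K] .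
  have xG: "x \<in> carrier G" using x(1) by (simp add: p_reg_def)
  obtain L where L: "subgroup L G" "H \<subseteq> L" "L \<subseteq> K" "card L = p * card H"
    using p_subgroup_cover[OF Kp H(1,2)] .
  have Lp: "p_subgroup L" using p_subgroup_subset[OF Kp L(1,3)] .
  interpret L: subgroup L G by (rule L(1))
  have LS: "L \<subseteq> S" using L(3) K(2) by blast
  have ab: "a \<otimes> b = b \<otimes> a" if "a \<in> L" "b \<in> L" for a b
    using abelian[OF L(1) LS] L(4) H(3) that by simp
  have xn: "x \<in> norm_of M" if "subgroup M G" "M \<subseteq> L" "card M = p ^ e" for M
    using norm_mono[OF that(1) _ K that(3)] that(2) L(3) x(2) by blast
  obtain n where pn: "\<And>y. y \<in> L \<Longrightarrow> y [^] (p ^ n) = \<one>" using p_subgroup_exponent[OF Lp] by blast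
  have HL: "H \<subset> L" using L(2,4) H(3) card_subgroup_pos[OF H(1)] p_gt_1 by auto
  show ?thesis
  proof (cases "\<exists>H'. subgroup H' G \<and> H' \<subseteq> L \<and> card H' = p ^ e \<and> H' \<noteq> H")
    case True
    then obtain H' where H': "subgroup H' G" "H' \<subseteq> L" "card H' = p ^ e" "H' \<noteq> H" by blast
    have xL: "x \<in> norm_of L"
    proof -
      \<comment> \<open>This subgroup contains both \<open>H\<close> and \<open>H'\<close>, hence
        \<open>H\<close> strictly, so its order is that of \<open>L\<close>.\<close>
      let ?L = "{l \<in> L. cj x l \<in> L}"
      have sL: "subgroup ?L G"
        by (rule subgroup_finiteI[OF finite_carrier]) (use xG in \<open>auto simp: cj_mult\<close>)
      have inL: "M \<subseteq> ?L" if "subgroup M G" "M \<subseteq> L" "card M = p ^ e" for M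
        using xn[OF that] that(2) by (auto simp: norm_of_def)
      have "\<not> H' \<subseteq> H" using H' H(3) card_subset_eq[OF finite_subgroup[OF H(1)]] by auto
      then have "H \<subset> ?L" using inL[OF H(1) L(2) H(3)] inL[OF H'(1-3)] by blast
      moreover have "p_subgroup ?L" using p_subgroup_subset[OF Lp sL] by blast
      ultimately have "p * card H dvd card ?L" using p_subgroup_card_psubset H(1) by blast
      then have "card L \<le> card ?L" using L(4) dvd_imp_le card_subgroup_pos[OF sL] by metis
      then have "?L = L" using card_seteq[OF finite_subgroup[OF L(1)], of ?L] by blast
      then show ?thesis
        using norm_of_iff_subset[OF finite_subgroup[OF L(1)] L.subset] xG by blast
    qed
    have cjL: "cj x y \<in> L" if "y \<in> L" for y using xL that by (auto simp: norm_of_def)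
    \<comment> \<open>\<open>x\<close> normalizes every subgroup of index \<open>p\<close> in
      \<open>L\<close>, as these have order \<open>p ^ e\<close>. So the displacement of
      \<open>y\<close> lies in all of them and is a \<open>p\<close>-th power.\<close>
    have step: "\<exists>v\<in>L. cj x y = y \<otimes> v [^] p" if y: "y \<in> L" for y
    proof -
      let ?w = "inv y \<otimes> cj x y"
      have "?w \<in> M" if "subgroup M G" "M \<subseteq> L" "card L = p * card M" for M
      proof -
        have "card M = p ^ e" using that(3) L(4) H(3) p_gt_1 by simp
        then show ?thesis
          using p_reg_trivial_on_index_p[OF coprime_pred x(1) Lp that xL xn[OF that(1,2)] y] by blast
      qed
      then obtain v where v: "v \<in> L" "?w = v [^] p"
        using abelian_p_power_if_in_index_p[OF Lp ab _] y cjL[OF y] by (metis L.m_closed L.m_inv_closed)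
      have "cj x y = y \<otimes> ?w" using y xG by simp
      then show ?thesis using v by metis
    qed
    \<comment> \<open>Downward from \<open>n\<close>, where the powers are trivial, to 0. On
      \<open>y [^] (p ^ j)\<close> the element \<open>x\<close> acts as translation by a
      \<open>p ^ Suc j\<close>-th power, which it fixes by the induction hypothesis.\<close>
    have fixed: "j \<le> n \<Longrightarrow> \<forall>y\<in>L. cj x (y [^] (p ^ j)) = y [^] (p ^ j)" for j
    proof (induction rule: inc_induct)
      case base
      then show ?case using pn xG by simp
    next
      case (step j)
      show ?case
      proof
        fix y assume y: "y \<in> L"
        obtain v where v: "v \<in> L" "cj x y = y \<otimes> v [^] p" using \<open>y \<in> L\<close> \<open>\<And>y. y \<in> L \<Longrightarrow> \<exists>v\<in>L. cj x y = y \<otimes> v [^] p\<close> by blast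
        have vp: "v [^] p \<in> L" using subgroup_nat_pow[OF L(1) v(1)] .
        define w where "w = v [^] (p ^ Suc j)"
        have w: "w \<in> carrier G" "w = (v [^] p) [^] (p ^ j)" "cj x w = w" "w [^] (p ^ n) = \<one>"
        proof -
          show "w \<in> carrier G" using v(1) by (simp add: w_def)
          show "w = (v [^] p) [^] (p ^ j)" using v(1) by (simp add: w_def nat_pow_pow)
          show "cj x w = w" using step.IH v(1) by (simp add: w_def)
          show "w [^] (p ^ n) = \<one>" using pn subgroup_nat_pow[OF L(1) v(1)] by (simp add: w_def)
        qed
        have "cj x (y [^] (p ^ j)) = (y \<otimes> v [^] p) [^] (p ^ j)" using v(2) y xG by (simp add: cj_pow)
        also have "\<dots> = y [^] (p ^ j) \<otimes> w" using pow_mult_distrib[OF ab[OF y vp]] y vp w(2) by simp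
        finally have eq: "cj x (y [^] (p ^ j)) = y [^] (p ^ j) \<otimes> w" .
        then have "w = \<one>" using coprime_translation_trivial[OF x(1) _ w(1) eq w(3,4)] y by simp
        then show "cj x (y [^] (p ^ j)) = y [^] (p ^ j)" using eq y by simp
      qed
    qed
    have "cj x y = y" if "y \<in> H" for y
      using fixed[of 0] that L(2) by auto
    then show ?thesis using xG by (simp add: cent_of_def)
  next
    case False
    then have unique: "H' = H" if "subgroup H' G" "H' \<subseteq> L" "card H' = p ^ e" for H' using that by blast
    obtain y where y: "y \<in> L" "y \<notin> H" using HL by blast
    have yG: "y \<in> carrier G" using y by simp
    have Y: "subgroup (powers y) G" using powers_subgroup[OF finite_carrier yG] .
    have YL: "powers y \<subseteq> L" using powers_subset[OF L(1) y(1)] .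
    \<comment> \<open>Otherwise \<open>powers y\<close> lies in a subgroup of \<open>L\<close> of
      order \<open>p ^ e\<close>, which can only be \<open>H\<close>, but \<open>y\<close> is
      outside \<open>H\<close>.\<close>
    have LY: "powers y = L"
    proof (rule ccontr)
      assume "powers y \<noteq> L"
      then have "powers y \<subset> L" using YL by blast
      then have "p * card (powers y) dvd p * p ^ e" using p_subgroup_card_psubset[OF Lp Y] L(4) H(3) by simp
      then have "card (powers y) dvd p ^ e" using p_gt_1 by simp
      then have "card (powers y) \<le> p ^ e" using dvd_imp_le p_gt_1 by simp
      moreover have "p ^ e \<le> card L" using L(4) H(3) p_gt_1 by simp
      ultimately obtain H' where "subgroup H' G" "powers y \<subseteq> H'" "H' \<subseteq> L" "card H' = p ^ e"
        using p_subgroup_between[OF Lp Y YL] by blast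
      then show False using unique y(2) self_in_powers[OF yG] by blast
    qed
    \<comment> \<open>By counting, the \<open>p\<close>-th power of the generator of
      \<open>L\<close> generates \<open>H\<close>. Now it is enough that \<open>x\<close> normalizes
      the cyclic group \<open>H\<close>.\<close>
    let ?h = "y [^] p"
    have h: "?h \<in> H" using index_p_contains(1)[OF Lp H(1) L(2,4) y(1)] .
    have hG: "?h \<in> carrier G" using yG by simp
    have Z: "subgroup (powers ?h) G" using powers_subgroup[OF finite_carrier hG] .
    have "powers y \<subseteq> {k \<otimes> y [^] i |k i::nat. k \<in> powers ?h}"
    proof
      fix a assume "a \<in> powers y"
      then obtain i :: nat where "a = \<one> \<otimes> y [^] i" using yG by (auto simp: powers_def)
      then show "a \<in> {k \<otimes> y [^] i |k i::nat. k \<in> powers ?h}" using subgroup.one_closed[OF Z] by blast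
    qed
    moreover have yn: "y \<in> norm_of (powers ?h)"
    proof -
      have "cj y k = k" if "k \<in> powers ?h" for k
      proof -
        have "k \<in> L" using that powers_subset[OF H(1) h] L(2) by blast
        then show ?thesis using cj_fixed_iff[OF yG] ab[OF y(1)] by simp
      qed
      then show ?thesis using yG by (auto simp: norm_of_def image_def)
    qed
    note ext = cyclic_extension[OF Z yn self_in_powers[OF hG]]
    ultimately have "card (powers y) \<le> p * card (powers ?h)"
      using ext(2) card_mono[OF finite_subgroup[OF ext(1)]] by (meson le_trans)
    then have "card H \<le> card (powers ?h)" using LY L(4) p_gt_1 by simp
    then have HZ: "powers ?h = H"
      using card_seteq[OF finite_subgroup[OF H(1)] powers_subset[OF H(1) h]] by simp
    have "cj x ?h \<in> powers ?h" using xn[OF H(1) L(2) H(3)] h HZ by (auto simp: norm_of_def)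
    moreover have "?h [^] (p ^ n) = \<one>" using pn h L(2) by blast
    ultimately have fh: "cj x ?h = ?h" using p_reg_centralizes_cyclic[OF coprime_pred x(1) hG] by blast
    have "cj x k = k" if "k \<in> H" for k
    proof -
      have "k \<in> powers ?h" using that HZ by simp
      then obtain i :: nat where "k = ?h [^] i" unfolding powers_def by blast
      then show ?thesis using fh xG hG by (simp add: cj_pow)
    qed
    then show ?thesis using xG by (simp add: cent_of_def)
  qed
qed

text \<open>An element of order at most \<open>p ^ e\<close> lies in a proper subgroup of
  \<open>K\<close> of order \<open>p ^ e\<close>, so \<open>x\<close> fixes it. This covers order
  \<open>p\<close>, and for \<open>p = 2\<close> also order 4 unless \<open>e = 1\<close>. In that
  case, with \<open>S\<close> non-abelian, \<open>norm_mono_four\<close> makes \<open>x\<close>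
  normalize the cyclic group of order 4, on which it then acts trivially.\<close>

lemma centralizes_large_subgroup_of_S:
  assumes K: "subgroup K G" "K \<subseteq> S" "p ^ e < card K" and x: "p_reg x" "x \<in> norm_of K"
  shows "x \<in> cent_of K"
proof -
  have Kp: "p_subgroup K" using p_subgroup_subset[OF S_p_subgroup K(1,2)] .
  have small: "cj x y = y" if y: "y \<in> K" and le: "card (powers y) \<le> p ^ e" for y
  proof -
    have yG: "y \<in> carrier G" using y subgroup.mem_carrier[OF K(1)] by blast
    obtain H where H: "subgroup H G" "powers y \<subseteq> H" "H \<subseteq> K" "card H = p ^ e"
      using p_subgroup_between[OF Kp powers_subgroup[OF finite_carrier yG] powers_subset[OF K(1) y] le] K(3) by auto
    have "H \<subset> K" using H(3,4) K(3) by auto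
    then have "x \<in> cent_of H" using centralizes_subgroup_of_card_pe[OF K(1,2) x H(1) _ H(4)] by blast
    then show ?thesis using H(2) self_in_powers[OF yG] by (auto simp: cent_of_def)
  qed
  show ?thesis
  proof (rule centralizes_if_small_orders[OF Kp x])
    fix y assume y: "y \<in> K" "y [^] p = \<one>"
    have yG: "y \<in> carrier G" using y subgroup.mem_carrier[OF K(1)] by blast
    have "p ^ 1 \<le> p ^ e" using e_pos p_gt_1 by (intro power_increasing) auto
    then have "card (powers y) \<le> p ^ e" using card_powers_le[OF yG y(2)] p_gt_1 by simp
    then show "cj x y = y" using small y(1) by blast
  next
    assume p2: "p = 2"
    show "(\<forall>a\<in>K. \<forall>b\<in>K. a \<otimes> b = b \<otimes> a) \<or> (\<forall>y\<in>K. y [^] (4::nat) = \<one> \<longrightarrow> cj x y = y)"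
    proof (cases "\<forall>a\<in>S. \<forall>b\<in>S. a \<otimes> b = b \<otimes> a")
      case True
      then show ?thesis using K(2) by blast
    next
      case nab: False
      have "cj x y = y" if y: "y \<in> K" "y [^] (4::nat) = \<one>" for y
      proof -
        have yG: "y \<in> carrier G" using y subgroup.mem_carrier[OF K(1)] by blast
        have le4: "card (powers y) \<le> 4" using card_powers_le[OF yG y(2)] by simp
        show ?thesis
        proof (cases "card (powers y) \<le> p ^ e")
          case True
          then show ?thesis using small y(1) by blast
        next
          case False
          obtain l where "card K = p ^ l" using Kp by (auto simp: p_subgroup_def)
          then obtain k where "card (powers y) = p ^ k"
            using subgroup_of_prime_power[OF K(1) _ powers_subgroup[OF finite_carrier yG] powers_subset[OF K(1) y(1)]]
            by blast
          then have k: "card (powers y) = 2 ^ k" using p2 by simp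
          have "(2::nat) ^ k \<le> 2 ^ 2" using le4 k by simp
          then have "k \<le> 2" by (simp only: power_increasing_iff)
          moreover have "(2::nat) ^ e < 2 ^ k" using False k p2 by simp
          then have "e < k" by simp
          ultimately have e1: "e = 1" "k = 2" using e_pos by auto
          then have "norm_of K \<subseteq> norm_of (powers y)"
            using norm_mono_four[OF p2 _ nab y(1) K(1,2)] k by simp
          then have "cj x y \<in> powers y" using x(2) self_in_powers[OF yG] by (auto simp: norm_of_def)
          then show ?thesis
            using p_reg_centralizes_cyclic[OF coprime_pred x(1) yG, of 2] y(2) p2 by simp
        qed
      qed
      then show ?thesis by blast
    qed
  qed
qed

lemma conj_into_S:
  assumes "p_subgroup K"
  obtains g where "g \<in> carrier G" "cj g ` K \<subseteq> S"
proof -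
  have "K \<subseteq> carrier G" using assms subgroup.subset by (auto simp: p_subgroup_def)
  then show ?thesis using p_subgroup_conj_sylow[OF subgroup_self S assms] that by blast
qed

lemma centralizes_large_p_subgroup:
  assumes K: "p_subgroup K" "p ^ e < card K" and x: "p_reg x" "x \<in> norm_of K"
  shows "x \<in> cent_of K"
proof -
  obtain g where g: "g \<in> carrier G" "cj g ` K \<subseteq> S" using conj_into_S[OF K(1)] .
  have sub: "subgroup K G" "K \<subseteq> carrier G" using K(1) subgroup.subset by (auto simp: p_subgroup_def)
  have xG: "x \<in> carrier G" using x(1) by (simp add: p_reg_def)
  have "cj g x \<in> cent_of (cj g ` K)"
    using centralizes_large_subgroup_of_S[OF subgroup_cj[OF sub(1) g(1)] g(2) _ p_reg_cj[OF x(1) g(1)]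
        norm_of_cj[OF x(2) g(1) sub(2)]] cj_image_card[OF g(1) sub(2)] K(2) by simp
  then show ?thesis using cent_of_cj_iff[OF xG g(1) sub(2)] by simp
qed

text \<open>A small subgroup \<open>K\<close> lies in a large abelian one, so its centralizer has a large Sylow
  \<open>p\<close>-subgroup \<open>P\<close>. By the Frattini argument \<open>x\<close> acts on \<open>K\<close> like some element of the normalizer
  of \<open>P\<close>.\<close>

lemma centralizes_small_subgroup_of_S:
  assumes K: "subgroup K G" "K \<subseteq> S" "card K \<le> p ^ e" and x: "p_reg x" "x \<in> norm_of K"
  shows "x \<in> cent_of K"
proof -
  have xG: "x \<in> carrier G" using x(1) by (simp add: p_reg_def)
  have KG: "K \<subseteq> carrier G" using K(1) subgroup.subset by blast
  obtain n where n: "card S = p ^ n" using S_p_subgroup by (auto simp: p_subgroup_def)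
  then have "e < n" using card_S p_gt_1 by simp
  then have "p ^ Suc e \<le> card S" using n p_gt_1 by (simp add: power_increasing del: power_Suc)
  moreover have "card K \<le> p ^ Suc e" using K(3) p_gt_1 by (metis le_trans less_imp_le power_increasing lessI)
  ultimately obtain L where L: "subgroup L G" "K \<subseteq> L" "L \<subseteq> S" "card L = p ^ Suc e"
    using p_subgroup_between[OF S_p_subgroup K(1,2)] by blast
  have LG: "L \<subseteq> carrier G" using L(1) subgroup.subset by blast
  let ?C = "cent_of K"
  have C: "subgroup ?C G" using cent_of_subgroup[OF KG] .
  have LC: "L \<subseteq> ?C"
  proof
    fix l assume l: "l \<in> L"
    have "cj l k = k" if "k \<in> K" for k
      using cj_fixed_iff[of l k] abelian[OF L(1,3) _ l] that L(2,4) LG l by auto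
    then show "l \<in> ?C" using l LG by (auto simp: cent_of_def)
  qed
  obtain P where P: "sylow_in ?C P" "L \<subseteq> P"
    using p_subgroup_in_sylow[OF C p_subgroup_subset[OF S_p_subgroup L(1,3)] LC] .
  have Psub: "subgroup P G" "P \<subseteq> ?C" using P(1) by (auto simp: sylow_in_def)
  have PG: "P \<subseteq> carrier G" using Psub(1) subgroup.subset by blast
  have "p ^ e < p ^ Suc e" using p_gt_1 by simp
  also have "\<dots> \<le> card P" using card_mono[OF finite_subgroup[OF Psub(1)] P(2)] L(4) by simp
  finally have Plarge: "p ^ e < card P" .
  have xP: "sylow_in ?C (cj x ` P)"
    using P(1) subgroup_cj[OF Psub(1) xG] cj_image_card[OF xG PG] cent_of_cj[OF KG x(2)] Psub(2)
    by (auto simp: sylow_in_def)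
  obtain c where c: "c \<in> ?C" "cj c ` cj x ` P = P" using sylow_in_conj[OF C xP P(1)] .
  have cG: "c \<in> carrier G" using c(1) by (simp add: cent_of_def)
  \<comment> \<open>\<open>m\<close> acts on \<open>K\<close> like \<open>x\<close>, because
    \<open>c\<close> centralizes \<open>K\<close>, and it normalizes the large subgroup
    \<open>P\<close>. It need not be \<open>p\<close>-regular, so a suitable power of it is
    taken.\<close>
  define m where "m = c \<otimes> x"
  have mG: "m \<in> carrier G" using cG xG by (simp add: m_def)
  have mP: "m \<in> norm_of P" using c(2) mG cj_image_comp[OF cG xG PG] by (simp add: norm_of_def m_def)
  obtain a where a: "p_reg (m [^] (p ^ a))" using p_part_power[OF mG] .
  have "m [^] (p ^ a) \<in> cent_of P"
    using centralizes_large_p_subgroup[OF sylow_in_p_subgroup[OF P(1)] Plarge a norm_of_pow[OF PG mP]] .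
  then have cent: "m [^] (p ^ a) \<in> cent_of K" using cent_of_antimono[of K P] L(2) P(2) by blast
  have xK: "cj (x [^] i) k \<in> K" if "k \<in> K" for k and i :: nat
    using norm_of_pow[OF KG x(2), of i] that by (auto simp: norm_of_def)
  have "cj (m [^] i) k = cj (x [^] i) k" if "k \<in> K" for k and i :: nat
    using that
  proof (induction i arbitrary: k)
    case (Suc i)
    have kG: "k \<in> carrier G" using Suc.prems KG by blast
    have xk: "cj x k \<in> K" using xK[OF Suc.prems, of 1] xG by simp
    have "cj m k = cj x k" using c(1) xk cG xG kG by (simp add: m_def cj_comp cent_of_def)
    then have "cj (m [^] Suc i) k = cj (m [^] i) (cj x k)" using mG kG by (simp add: cj_comp)
    also have "\<dots> = cj (x [^] Suc i) k" using Suc.IH[OF xk] xG kG by (simp add: cj_comp)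
    finally show ?case .
  qed simp
  then have xa: "x [^] (p ^ a) \<in> cent_of K" using cent xG by (simp add: cent_of_def)
  \<comment> \<open>As its order is prime to \<open>p\<close>, \<open>x\<close> is itself a power of
    \<open>x [^] (p ^ a)\<close>.\<close>
  have "coprime (p ^ a) (ord x)" using x(1) by (simp add: p_reg_def)
  then obtain i j where ij: "p ^ a * i = ord x * j + 1"
    using bezout_nat[of "p ^ a" "ord x"] p_gt_1 by auto
  have "x [^] (ord x * j) = (x [^] ord x) [^] j" using nat_pow_pow[OF xG] by simp
  also have "\<dots> = \<one>" using xG by (simp only: pow_ord_eq_1 nat_pow_one)
  finally have "x [^] (p ^ a * i) = x" using ij xG by simp
  then have "(x [^] (p ^ a)) [^] i = x" using xG by (simp add: nat_pow_pow)
  then show ?thesis using subgroup_nat_pow[OF C xa, of i] by simp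
qed

lemma frobenius_condition_holds: "frobenius_condition"
  unfolding frobenius_condition_def
proof (intro allI impI, elim conjE)
  fix K x assume K: "p_subgroup K" and x: "p_reg x" "x \<in> norm_of K"
  show "x \<in> cent_of K"
  proof (cases "p ^ e < card K")
    case True
    then show ?thesis using centralizes_large_p_subgroup[OF K _ x] by blast
  next
    case False
    obtain g where g: "g \<in> carrier G" "cj g ` K \<subseteq> S" using conj_into_S[OF K] .
    have sub: "subgroup K G" "K \<subseteq> carrier G" using K subgroup.subset by (auto simp: p_subgroup_def)
    have xG: "x \<in> carrier G" using x(1) by (simp add: p_reg_def)
    have "cj g x \<in> cent_of (cj g ` K)"
      using centralizes_small_subgroup_of_S[OF subgroup_cj[OF sub(1) g(1)] g(2) _ p_reg_cj[OF x(1) g(1)]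
          norm_of_cj[OF x(2) g(1) sub(2)]] cj_image_card[OF g(1) sub(2)] False by simp
    then show ?thesis using cent_of_cj_iff[OF xG g(1) sub(2)] by simp
  qed
qed

end

theorem corollary5p1:
  fixes G :: "('a, 'b) monoid_scheme" and p :: nat and S :: "'a set"
  assumes "group G"
    and "finite (carrier G)"
    and "Factorial_Ring.prime p"
    and "p dvd order G"
    and "coprime (p - 1) (order G)"
    and "sylow_subgroup p G S"
    and "\<exists>D. subgroup D G \<and> D \<subseteq> S \<and> 1 < card D \<and> card D < card S \<and>
           (\<forall>H. subgroup H G \<and> H \<subseteq> S \<and> card H = card D \<longrightarrow>
              comm_group (G\<lparr>carrier := H\<rparr>) \<and> subnormalizer_condition G S H) \<and>
           (\<forall>H. subgroup H G \<and> H \<subseteq> S \<and> card H = p * card D \<longrightarrow>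
              comm_group (G\<lparr>carrier := H\<rparr>)) \<and>
           (\<not> comm_group (G\<lparr>carrier := S\<rparr>) \<and> p = 2 \<and> card D = 2 \<longrightarrow>
              (\<forall>C. subgroup C G \<and> C \<subseteq> S \<and> cyclic_group (G\<lparr>carrier := C\<rparr>) \<and> card C = 4 \<longrightarrow>
                 subnormalizer_condition G S C))"
  shows "p_nilpotent p G"
proof -
  interpret finite_group_prime G p
    using assms(1-3) by (simp add: finite_group_prime_def finite_group_prime_axioms_def)
  have S: "sylow_in (carrier G) S"
    using assms(6) subgroup.subset by (auto simp: sylow_in_def sylow_subgroup_def order_def)
  then have Ssub: "subgroup S G" by (simp add: sylow_in_def)
  from assms(7) obtain D where D: "subgroup D G" "D \<subseteq> S" "1 < card D" "card D < card S"
    and sub: "\<forall>H. subgroup H G \<and> H \<subseteq> S \<and> card H = card D \<longrightarrow>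
      comm_group (G\<lparr>carrier := H\<rparr>) \<and> subnormalizer_condition G S H"
    and ab': "\<forall>H. subgroup H G \<and> H \<subseteq> S \<and> card H = p * card D \<longrightarrow> comm_group (G\<lparr>carrier := H\<rparr>)"
    and four': "\<not> comm_group (G\<lparr>carrier := S\<rparr>) \<and> p = 2 \<and> card D = 2 \<longrightarrow>
      (\<forall>C. subgroup C G \<and> C \<subseteq> S \<and> cyclic_group (G\<lparr>carrier := C\<rparr>) \<and> card C = 4 \<longrightarrow>
        subnormalizer_condition G S C)"
    by (elim exE conjE) (rule that)
  have sn: "subnormalizer_condition G S H" if "subgroup H G" "H \<subseteq> S" "card H = card D" for H
    using sub that by blast
  have ab: "comm_group (G\<lparr>carrier := H\<rparr>)" if "subgroup H G" "H \<subseteq> S" "card H = p * card D" for H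
    using ab' that by blast
  have four: "subnormalizer_condition G S C"
    if "\<not> comm_group (G\<lparr>carrier := S\<rparr>)" "p = 2" "card D = 2" "subgroup C G" "C \<subseteq> S"
      "cyclic_group (G\<lparr>carrier := C\<rparr>)" "card C = 4" for C
    using four' that by blast
  obtain e where e: "card D = p ^ e"
    using subgroup_of_prime_power[OF Ssub _ D(1,2)] S by (metis sylow_in_def)
  have sn_norm: "norm_of K \<subseteq> norm_of H"
    if "subnormalizer_condition G S H" "subgroup H G" "H \<subseteq> K" "subgroup K G" "K \<subseteq> S" for H K
    using that normalizer_eq_norm_of subgroup.subset by (metis subnormalizer_condition_def)
  have "subnormalizer_setting G p S e"
  proof (rule subnormalizer_setting.intro[OF finite_group_prime_axioms], rule subnormalizer_setting_axioms.intro)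
    show "0 < e" using D(3) e by (cases e) auto
    show "p ^ e < card S" using D(4) e by simp
    show "norm_of K \<subseteq> norm_of H"
      if "subgroup H G" "H \<subseteq> K" "subgroup K G" "K \<subseteq> S" "card H = p ^ e" for H K
      using sn_norm[OF sn] that e by auto
    show "a \<otimes>\<^bsub>G\<^esub> b = b \<otimes>\<^bsub>G\<^esub> a"
      if "subgroup L G" "L \<subseteq> S" "card L = p * p ^ e" "a \<in> L" "b \<in> L" for L a b
      using comm_groupE(4)[OF ab[OF that(1,2)], of a b] that(3-5) e by simp
    fix y K
    assume p2: "p = 2" and e1: "e = 1" and nab: "\<not> (\<forall>a\<in>S. \<forall>b\<in>S. a \<otimes>\<^bsub>G\<^esub> b = b \<otimes>\<^bsub>G\<^esub> a)"
      and y: "y \<in> K" and K: "subgroup K G" "K \<subseteq> S" and card4: "card (powers y) = 4"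
    have yG: "y \<in> carrier G" using y K(1) subgroup.mem_carrier by metis
    have C: "subgroup (powers y) G" using powers_subgroup[OF finite_carrier yG] .
    interpret C: group "G\<lparr>carrier := powers y\<rparr>" using C by (rule subgroup_imp_group)
    have yC: "y \<in> powers y" using self_in_powers[OF yG] .
    \<comment> \<open>The characterization of \<open>cyclic_group\<close> uses integer powers in the
      substructure, while \<open>powers\<close> uses natural exponents in \<open>G\<close>.\<close>
    have "powers y = range (\<lambda>n::int. y [^]\<^bsub>G\<lparr>carrier := powers y\<rparr>\<^esub> n)"
    proof (intro equalityI subsetI)
      fix a assume "a \<in> powers y"
      then obtain i :: nat where "a = y [^]\<^bsub>G\<^esub> i" by (auto simp: powers_def)
      then have "a = y [^]\<^bsub>G\<lparr>carrier := powers y\<rparr>\<^esub> int i"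
        using int_pow_consistent[OF C yC, of "int i"] by (simp add: int_pow_int)
      then show "a \<in> range (\<lambda>n::int. y [^]\<^bsub>G\<lparr>carrier := powers y\<rparr>\<^esub> n)" by blast
    next
      fix a assume "a \<in> range (\<lambda>n::int. y [^]\<^bsub>G\<lparr>carrier := powers y\<rparr>\<^esub> n)"
      then show "a \<in> powers y" using C.int_pow_closed[of y] yC by auto
    qed
    then have cyc: "cyclic_group (G\<lparr>carrier := powers y\<rparr>)" using C.cyclic_group yC by auto
    have ncomm: "\<not> comm_group (G\<lparr>carrier := S\<rparr>)"
      using nab comm_groupE(4)[of "G\<lparr>carrier := S\<rparr>"] by auto
    have CK: "powers y \<subseteq> K" using powers_subset[OF K(1) y] .
    then show "norm_of K \<subseteq> norm_of (powers y)"
      using sn_norm[OF four[OF ncomm p2 _ C _ cyc card4] C CK K] e e1 p2 K(2) by auto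
  qed (use S assms(5) in auto)
  then show ?thesis using frobenius_p_nilpotent subnormalizer_setting.frobenius_condition_holds by blast
qed

end
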